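(* Let $n\ge 3$ and $(l_1,\dots,l_n)\in\mathbb{R}_+^n$, let $G$ be an $n$-gear with lengths $(l_1,\dots,l_n)$, and let $\tilde G$ be its dual $n$-gear. Then for every weight $w>0$, $G$ and $\tilde G$ are isospectral, i.e. the operators $\Delta$ on $G$ and on $\tilde G$ with the $w$-weighted vertex conditions have the same spectrum, including multiplicities.
   Context: All lengths are positive real numbers. An $n$-gear is a finite metric (quantum) graph with $2n$ vertices comprised of a polygon (cycle) with $n$ sides $p_1,\dots,p_n$ of lengths $l_1,\dots,l_n$, together with $n$ leaf edges $t_1,\dots,t_n$ of lengths $l_1,\dots,l_n$, called teeth, such that the $i$th tooth $t_i$ is attached at one of the two end vertices of the $i$th polygon side $p_i$, its other end being a leaf vertex (of degree 1). Thus there are $n$ polygon vertices, each of degree $2$, $3$ or $4$, and $n$ leaf vertices. The dual $n$-gear is obtained by attaching each tooth $t_i$ at the other end vertex of its corresponding polygon side $p_i$ instead. Each edge of length $l$ is identified with the interval $[0,l]$, and the operator $\Delta$ acts as $-\frac{d^2}{dx^2}$ on each edge, on functions that are $H^2$ on every edge and satisfy the following vertex conditions, depending on a weight $w>0$. At each leaf vertex the derivative vanishes (Neumann condition). At each polygon vertex $v$, the restrictions of the function to all edges adjacent to $v$ take the same value at $v$, and $$\sum_{\text{polygon sides } p \text{ at } v}\partial_p f(v)+w\sum_{\text{teeth } t \text{ attached at } v}\partial_t f(v)=0,$$ where $\partial_e f(v)$ denotes the derivative of $f$ at $v$ along the edge $e$ in the direction pointing away from $v$. (For $w=1$ these are the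 usual Kirchhoff-Neumann conditions.) The operator is self-adjoint with respect to the measure that is Lebesgue measure on polygon sides and $w$ times Lebesgue measure on teeth, and it has discrete spectrum. Two quantum graphs are called isospectral if the spectra of their operators coincide, including multiplicities. *)

theory Defs
  imports "HOL-Analysis.Analysis" "HOL-Library.Function_Algebras"
begin

text \<open>
  The polygon vertices of an \<open>n\<close>-gear are the numbers \<open>0, \<dots>, n - 1\<close>, and the \<open>i\<close>th polygon side
  (\<open>i < n\<close>) joins the vertices \<open>i\<close> and \<open>i + 1\<close> modulo \<open>n\<close>. The \<open>i\<close>th tooth joins the polygon vertex
  \<open>att i\<close> to its own leaf vertex.
\<close>

record gear =
  sides :: nat
  len :: "nat \<Rightarrow> real"
  att :: "nat \<Rightarrow> nat"

definition nxt :: "gear \<Rightarrow> nat \<Rightarrow> nat" where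
  "nxt G i = Suc i mod sides G"

definition is_gear :: "nat \<Rightarrow> (nat \<Rightarrow> real) \<Rightarrow> gear \<Rightarrow> bool" where
  "is_gear n l G \<longleftrightarrow> sides G = n \<and> (\<forall>i<n. len G i = l i \<and> att G i \<in> {i, nxt G i})"

definition dual_gear :: "gear \<Rightarrow> gear" where
  "dual_gear G = G\<lparr>att := (\<lambda>i. if att G i = i then nxt G i else i)\<rparr>"

text \<open>
  \<open>Side i\<close> is parametrised by \<open>[0, len i]\<close> from vertex \<open>i\<close> to vertex \<open>i + 1\<close>, and \<open>Tooth i\<close> by the
  same interval from its attachment vertex to its leaf.
\<close>

datatype edge = Side nat | Tooth nat

definition edges :: "gear \<Rightarrow> edge set" where
  "edges G = Side ` {..<sides G} \<union> Tooth ` {..<sides G}"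

primrec elen :: "gear \<Rightarrow> edge \<Rightarrow> real" where
  "elen G (Side i) = len G i"
| "elen G (Tooth i) = len G i"

type_synonym edge_fun = "edge \<Rightarrow> real \<Rightarrow> complex"

definition L2_on :: "real \<Rightarrow> (real \<Rightarrow> complex) \<Rightarrow> bool" where
  "L2_on l f \<longleftrightarrow> f \<in> borel_measurable (lebesgue_on {0..l})
     \<and> integrable (lebesgue_on {0..l}) (\<lambda>x. (cmod (f x))\<^sup>2)"

text \<open>
  \<open>u\<close> is (the continuously differentiable representative of) a function in \<open>H\<^sup>2(0, l)\<close> with second
  weak derivative \<open>g\<close>: the classical derivative \<open>v\<close> of \<open>u\<close> on \<open>[0, l]\<close>, one-sided at the end points,
  is absolutely continuous with \<open>v' = g\<close> almost everywhere and \<open>g\<close> in \<open>L\<^sup>2\<close>. Thus \<open>g\<close> is determined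
  only up to null sets.
\<close>

definition H2_deriv2 :: "real \<Rightarrow> (real \<Rightarrow> complex) \<Rightarrow> (real \<Rightarrow> complex) \<Rightarrow> bool" where
  "H2_deriv2 l u g \<longleftrightarrow> L2_on l g \<and>
     (\<exists>v. \<forall>x\<in>{0..l}. (u has_vector_derivative v x) (at x within {0..l})
                      \<and> (g has_integral (v x - v 0)) {0..x})"

definition H2_on :: "real \<Rightarrow> (real \<Rightarrow> complex) \<Rightarrow> bool" where
  "H2_on l u \<longleftrightarrow> (\<exists>g. H2_deriv2 l u g)"

definition edge_deriv :: "gear \<Rightarrow> edge_fun \<Rightarrow> edge \<Rightarrow> real \<Rightarrow> complex" where
  "edge_deriv G u e x = vector_derivative (u e) (at x within {0..elen G e})"

definition continuous_at_vertices :: "gear \<Rightarrow> edge_fun \<Rightarrow> bool" where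
  "continuous_at_vertices G u \<longleftrightarrow> (\<exists>val :: nat \<Rightarrow> complex. \<forall>i<sides G.
     u (Side i) 0 = val i \<and> u (Side i) (len G i) = val (nxt G i) \<and> u (Tooth i) 0 = val (att G i))"

text \<open>The derivative at the far end of a side enters with a minus sign, to point away from the vertex.\<close>

definition weighted_kirchhoff :: "real \<Rightarrow> gear \<Rightarrow> edge_fun \<Rightarrow> bool" where
  "weighted_kirchhoff w G u \<longleftrightarrow> (\<forall>v<sides G.
     edge_deriv G u (Side v) 0
     + (\<Sum>i | i < sides G \<and> nxt G i = v. - edge_deriv G u (Side i) (len G i))
     + of_real w * (\<Sum>i | i < sides G \<and> att G i = v. edge_deriv G u (Tooth i) 0) = 0)"

definition leaf_neumann :: "gear \<Rightarrow> edge_fun \<Rightarrow> bool" where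
  "leaf_neumann G u \<longleftrightarrow> (\<forall>i<sides G. edge_deriv G u (Tooth i) (len G i) = 0)"

text \<open>
  The functions of the domain are required to vanish off the edges, so that a function on the metric
  graph has exactly one representative of type \<open>edge_fun\<close>.
\<close>

definition lap_domain :: "real \<Rightarrow> gear \<Rightarrow> edge_fun set" where
  "lap_domain w G = {u.
     (\<forall>e x. e \<notin> edges G \<or> x \<notin> {0..elen G e} \<longrightarrow> u e x = 0)
     \<and> (\<forall>e\<in>edges G. H2_on (elen G e) (u e))
     \<and> continuous_at_vertices G u \<and> weighted_kirchhoff w G u \<and> leaf_neumann G u}"

definition L2_graph :: "gear \<Rightarrow> edge_fun set" where
  "L2_graph G = {f. \<forall>e\<in>edges G. L2_on (elen G e) (f e)}"

definition L2_graph_norm :: "real \<Rightarrow> gear \<Rightarrow> edge_fun \<Rightarrow> real" where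
  "L2_graph_norm w G f = sqrt (\<Sum>i<sides G.
      integral\<^sup>L (lebesgue_on {0..len G i}) (\<lambda>x. (cmod (f (Side i) x))\<^sup>2)
      + w * integral\<^sup>L (lebesgue_on {0..len G i}) (\<lambda>x. (cmod (f (Tooth i) x))\<^sup>2))"

text \<open>
  \<open>laplacian w G u f\<close>: \<open>u\<close> lies in the domain of \<open>\<Delta>\<close> and \<open>\<Delta> u = f\<close> in \<open>L\<^sup>2\<close>, that is, almost
  everywhere on every edge.
\<close>

definition laplacian :: "real \<Rightarrow> gear \<Rightarrow> edge_fun \<Rightarrow> edge_fun \<Rightarrow> bool" where
  "laplacian w G u f \<longleftrightarrow> u \<in> lap_domain w G \<and>
     (\<forall>e\<in>edges G. H2_deriv2 (elen G e) (u e) (\<lambda>x. - f e x))"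

text \<open>
  \<open>\<Delta> - \<mu>\<close> is a bijection from the domain onto \<open>L\<^sup>2\<close> with bounded inverse; the equation
  \<open>(\<Delta> - \<mu>) u = f\<close> is written as \<open>\<Delta> u = f + \<mu> u\<close>.
\<close>

definition resolvent_set :: "real \<Rightarrow> gear \<Rightarrow> complex set" where
  "resolvent_set w G = {\<mu>.
     (\<forall>f\<in>L2_graph G. \<exists>!u. laplacian w G u (\<lambda>e x. f e x + \<mu> * u e x))
     \<and> (\<exists>C. \<forall>f\<in>L2_graph G. \<forall>u. laplacian w G u (\<lambda>e x. f e x + \<mu> * u e x)
              \<longrightarrow> L2_graph_norm w G u \<le> C * L2_graph_norm w G f)}"

definition lap_spectrum :: "real \<Rightarrow> gear \<Rightarrow> complex set" where
  "lap_spectrum w G = - resolvent_set w G"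

definition eigenspace :: "real \<Rightarrow> gear \<Rightarrow> complex \<Rightarrow> edge_fun set" where
  "eigenspace w G \<mu> = {u. laplacian w G u (\<lambda>e x. \<mu> * u e x)}"

definition scale_fun :: "complex \<Rightarrow> edge_fun \<Rightarrow> edge_fun" where
  "scale_fun c u = (\<lambda>e x. c * u e x)"

interpretation edge_fun: vector_space scale_fun
  by unfold_locales (auto simp: scale_fun_def fun_eq_iff algebra_simps)

text \<open>
  The dimension of an infinite-dimensional space would be \<open>0\<close> here, but eigenspaces have dimension
  at most \<open>4 * sides G\<close>, since on every edge there are two linearly independent solutions of
  \<open>- u'' = \<mu> u\<close>. As \<open>\<Delta>\<close> is self-adjoint, the geometric multiplicity is the multiplicity.
\<close>

definition multiplicity :: "real \<Rightarrow> gear \<Rightarrow> complex \<Rightarrow> nat" where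
  "multiplicity w G \<mu> = edge_fun.dim (eigenspace w G \<mu>)"

definition isospectral :: "real \<Rightarrow> gear \<Rightarrow> gear \<Rightarrow> bool" where
  "isospectral w G H \<longleftrightarrow> lap_spectrum w G = lap_spectrum w H
     \<and> (\<forall>\<mu>\<in>lap_spectrum w G. multiplicity w G \<mu> = multiplicity w H \<mu>)"

end

theory Submission imports Defs begin

text \<open>
  Let \<open>f\<close> be an eigenfunction on a side and \<open>h\<close> the eigenfunction on its tooth, both parametrised in
  the direction of the side. The map \<open>(f, h) \<mapsto> (f' + w h', f' - h')\<close> exchanges the continuity and the
  Kirchhoff conditions at the polygon vertices, and turns a tooth attached at one end of its side into
  a tooth attached at the other end. Hence it maps the \<open>\<mu>\<close>-eigenspace of a gear into that of the dual
  gear, and applying it twice multiplies by \<open>- (1 + w) \<mu>\<close>; so it is an isomorphism for \<open>\<mu> \<noteq> 0\<close>. For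
  \<open>\<mu> = 0\<close> both eigenspaces consist of the constants.

  The resolvent sets agree because, for \<open>\<mu> \<noteq> 0\<close>, a point lies in the resolvent set as soon as its
  eigenspace is trivial: after subtracting an \<open>L\<^sup>2\<close>-bounded particular solution on every edge, the vertex
  conditions form a square linear system for the coefficients of \<open>cos (k x)\<close> and \<open>sin (k x)\<close>, where
  \<open>k\<^sup>2 = \<mu>\<close>.
\<close>

section \<open>Square integrable functions on an interval\<close>

text \<open>The exchange of conditions becomes visible when a side and its tooth are read as one
  segment. Since h' vanishes at the leaf, f' + w h' is the flux of the segment at both ends, so the
  Kirchhoff condition says that the fluxes of consecutive segments agree at their common vertex:
  this is continuity of the new side function. The new tooth function f' - h' agrees with f' + w h'
  where h' = 0, that is, at the end opposite to the old attachment, and its derivative, a multiple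
  of f - h, vanishes at the old attachment; this is why the tooth changes ends. Conversely the flux
  of the new segment at a vertex is -(1 + w) \<mu> times the old value there, so old continuity
  gives the new Kirchhoff condition.

  Eigenspaces alone do not settle the spectrum: \<open>resolvent_set\<close> asks for solvability
  for all square integrable data, with a norm bound uniform in the data. Hence the estimates below
  carry explicit constants, and the linear algebra must deliver solutions that depend linearly on
  the data.\<close>

lemma L2_on_add:
  assumes "L2_on l f" "L2_on l g"
  shows "L2_on l (\<lambda>x. f x + g x)"
proof -
  have m: "(\<lambda>x. f x + g x) \<in> borel_measurable (lebesgue_on {0..l})"
    using assms by (auto simp: L2_on_def)
  have i: "integrable (lebesgue_on {0..l}) (\<lambda>x. 2 * (cmod (f x))\<^sup>2 + 2 * (cmod (g x))\<^sup>2)"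
    using assms by (auto simp: L2_on_def)
  have "(cmod (f x + g x))\<^sup>2 \<le> 2 * (cmod (f x))\<^sup>2 + 2 * (cmod (g x))\<^sup>2" for x
  proof -
    have "(cmod (f x + g x))\<^sup>2 \<le> (cmod (f x) + cmod (g x))\<^sup>2"
      by (intro power_mono norm_triangle_ineq) auto
    also have "\<dots> \<le> 2 * (cmod (f x))\<^sup>2 + 2 * (cmod (g x))\<^sup>2"
      using zero_le_power2[of "cmod (f x) - cmod (g x)"] by (simp add: power2_sum power2_diff)
    finally show ?thesis .
  qed
  then have "integrable (lebesgue_on {0..l}) (\<lambda>x. (cmod (f x + g x))\<^sup>2)"
    using m by (intro Bochner_Integration.integrable_bound[OF i]) auto
  then show ?thesis using m by (simp add: L2_on_def)
qed

lemma L2_on_cmult: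
  assumes "L2_on l f"
  shows "L2_on l (\<lambda>x. c * f x)"
  using assms by (auto simp: L2_on_def norm_mult power_mult_distrib)

lemma L2_on_continuous:
  assumes "continuous_on {0..l} f"
  shows "L2_on l f"
proof -
  have "continuous_on {0..l} (\<lambda>x. (cmod (f x))\<^sup>2)"
    by (intro continuous_intros assms)
  then have "integrable (lebesgue_on {0..l}) (\<lambda>x. (cmod (f x))\<^sup>2)"
    by (rule continuous_imp_integrable_real)
  with assms show ?thesis
    by (simp add: L2_on_def continuous_imp_measurable_on_sets_lebesgue)
qed

lemma L2_on_cong:
  assumes "\<And>x. x \<in> {0..l} \<Longrightarrow> f x = g x"
  shows "L2_on l f \<longleftrightarrow> L2_on l g"
proof -
  have "f \<in> borel_measurable (lebesgue_on {0..l}) \<longleftrightarrow> g \<in> borel_measurable (lebesgue_on {0..l})"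
    using assms by (intro measurable_cong) auto
  moreover have "integrable (lebesgue_on {0..l}) (\<lambda>x. (cmod (f x))\<^sup>2) \<longleftrightarrow>
      integrable (lebesgue_on {0..l}) (\<lambda>x. (cmod (g x))\<^sup>2)"
    using assms by (intro Bochner_Integration.integrable_cong) auto
  ultimately show ?thesis by (simp add: L2_on_def)
qed

definition L2_norm_on :: "real \<Rightarrow> (real \<Rightarrow> complex) \<Rightarrow> real" where
  "L2_norm_on l f = sqrt (integral\<^sup>L (lebesgue_on {0..l}) (\<lambda>x. (cmod (f x))\<^sup>2))"

lemma L2_norm_on_nonneg: "0 \<le> L2_norm_on l f"
  by (simp add: L2_norm_on_def)

lemma L2_on_integrable:
  assumes "L2_on l f"
  shows "integrable (lebesgue_on {0..l}) f"
proof -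
  have i: "integrable (lebesgue_on {0..l}) (\<lambda>x. 1 + (cmod (f x))\<^sup>2)"
    using assms by (auto simp: L2_on_def intro!: continuous_imp_integrable_real)
  have "cmod (f x) \<le> 1 + (cmod (f x))\<^sup>2" for x
  proof -
    have "2 * cmod (f x) \<le> 1 + (cmod (f x))\<^sup>2"
      using zero_le_power2[of "cmod (f x) - 1"] by (simp add: power2_diff)
    then show ?thesis using norm_ge_zero[of "f x"] by linarith
  qed
  then show ?thesis
    using assms by (intro Bochner_Integration.integrable_bound[OF i]) (auto simp: L2_on_def)
qed

text \<open>Cauchy-Schwarz against the constant 1, obtained from nonnegativity of the variance:
  \<open>m / l\<close> is the mean of \<open>cmod (f x)\<close> over the interval.\<close>

lemma integral_norm_le_L2_norm:
  assumes l: "l > 0" and f: "L2_on l f"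
  shows "integral\<^sup>L (lebesgue_on {0..l}) (\<lambda>x. cmod (f x)) \<le> sqrt l * L2_norm_on l f"
proof -
  let ?M = "lebesgue_on {0..l}"
  define m where "m = integral\<^sup>L ?M (\<lambda>x. cmod (f x))"
  define q where "q = integral\<^sup>L ?M (\<lambda>x. (cmod (f x))\<^sup>2)"
  have i1: "integrable ?M (\<lambda>x. cmod (f x))"
    using L2_on_integrable[OF f] by simp
  have i2: "integrable ?M (\<lambda>x. (cmod (f x))\<^sup>2)"
    using f by (simp add: L2_on_def)
  have i0: "integrable ?M (\<lambda>x. (m / l)\<^sup>2)"
    by (intro continuous_imp_integrable_real continuous_intros)
  have c: "integral\<^sup>L ?M (\<lambda>x. (m / l)\<^sup>2) = (m / l)\<^sup>2 * l"
    using l by (simp add: measure_restrict_space)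
  have "0 \<le> integral\<^sup>L ?M (\<lambda>x. (cmod (f x) - m / l)\<^sup>2)"
    by (intro Bochner_Integration.integral_nonneg) auto
  also have "\<dots> = integral\<^sup>L ?M (\<lambda>x. (cmod (f x))\<^sup>2 + (m / l)\<^sup>2 - 2 * (m / l) * cmod (f x))"
    by (intro Bochner_Integration.integral_cong) (auto simp: power2_diff)
  also have "\<dots> = q + (m / l)\<^sup>2 * l - 2 * (m / l) * m"
    using i0 i1 i2 c by (simp add: m_def q_def)
  also have "\<dots> = q - m\<^sup>2 / l"
    using l by (simp add: power2_eq_square field_simps)
  finally have "m\<^sup>2 \<le> l * q"
    using l by (simp add: field_simps)
  then have "m \<le> sqrt (l * q)"
    by (rule real_le_rsqrt)
  then show ?thesis
    by (simp add: m_def q_def L2_norm_on_def real_sqrt_mult)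
qed

lemma integral_norm_squared_le_bound:
  assumes l: "l > 0" and f: "L2_on l f" and b: "\<And>x. x \<in> {0..l} \<Longrightarrow> cmod (f x) \<le> b"
  shows "integral\<^sup>L (lebesgue_on {0..l}) (\<lambda>x. (cmod (f x))\<^sup>2) \<le> l * b\<^sup>2"
proof -
  have "integral\<^sup>L (lebesgue_on {0..l}) (\<lambda>x. (cmod (f x))\<^sup>2) \<le> integral\<^sup>L (lebesgue_on {0..l}) (\<lambda>x. b\<^sup>2)"
    using f b by (intro integral_mono_AE AE_I2 power_mono)
      (auto simp: L2_on_def intro!: continuous_imp_integrable_real)
  also have "\<dots> = l * b\<^sup>2"
    using l by (simp add: measure_restrict_space)
  finally show ?thesis .
qed

text \<open>The passage from the Lebesgue integral in \<open>L2_on\<close> to the gauge integral in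
  \<open>H2_deriv2\<close>. The bound is uniform in \<open>x\<close>, which is the source of all
  later resolvent estimates.\<close>

lemma L2_on_primitive:
  assumes l: "l > 0" and f: "L2_on l f" and x: "x \<in> {0..l}"
  shows "(f has_integral integral {0..x} f) {0..x}"
    and "cmod (integral {0..x} f) \<le> sqrt l * L2_norm_on l f"
proof -
  have ii: "f integrable_on {0..l}" and ni: "(\<lambda>x. cmod (f x)) integrable_on {0..l}"
    using L2_on_integrable[OF f] integrable_on_lebesgue_on[of "{0..l}" f]
      integrable_on_lebesgue_on[of "{0..l}" "\<lambda>x. cmod (f x)"] by auto
  have sub: "{0..x} \<subseteq> {0..l}" using x by auto
  have ix: "f integrable_on {0..x}" "(\<lambda>x. cmod (f x)) integrable_on {0..x}"
    using integrable_on_subinterval[OF ii sub] integrable_on_subinterval[OF ni sub] by auto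
  show "(f has_integral integral {0..x} f) {0..x}"
    using ix by (rule_tac integrable_integral)
  have "cmod (integral {0..x} f) \<le> integral {0..x} (\<lambda>x. cmod (f x))"
    using ix by (intro integral_norm_bound_integral) auto
  also have "\<dots> \<le> integral {0..l} (\<lambda>x. cmod (f x))"
    by (intro integral_subset_le sub ix ni) auto
  also have "\<dots> = integral\<^sup>L (lebesgue_on {0..l}) (\<lambda>x. cmod (f x))"
    using L2_on_integrable[OF f] by (subst lebesgue_integral_eq_integral) auto
  also have "\<dots> \<le> sqrt l * L2_norm_on l f"
    by (rule integral_norm_le_L2_norm[OF l f])
  finally show "cmod (integral {0..x} f) \<le> sqrt l * L2_norm_on l f" .
qed

lemma L2_on_primitive_continuous:
  assumes f: "L2_on l f"
  shows "continuous_on {0..l} (\<lambda>x. integral {0..x} f)"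
  using L2_on_integrable[OF f] integrable_on_lebesgue_on[of "{0..l}" f]
  by (intro indefinite_integral_continuous_1) auto

section \<open>The equation $-u'' = f + \mu u$ on an interval\<close>

text \<open>Functions in the domain are cut off to 0 outside the edges, while solution formulas are
  smooth on the whole line; this lemma moves between the two.\<close>

lemma H2_deriv2_cong:
  assumes "\<And>x. x \<in> {0..l} \<Longrightarrow> u x = u' x" "\<And>x. x \<in> {0..l} \<Longrightarrow> g x = g' x"
  shows "H2_deriv2 l u g \<longleftrightarrow> H2_deriv2 l u' g'"
proof -
  have d: "(u has_vector_derivative d) (at x within {0..l}) \<longleftrightarrow>
      (u' has_vector_derivative d) (at x within {0..l})" if "x \<in> {0..l}" for x d
    using assms(1) that by (intro has_vector_derivative_cong_ev) (auto simp: eventually_at_filter)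
  have i: "(g has_integral d) {0..x} \<longleftrightarrow> (g' has_integral d) {0..x}" if "x \<in> {0..l}" for x d
    using assms(2) that by (intro has_integral_cong) auto
  show ?thesis
    unfolding H2_deriv2_def using d i L2_on_cong[OF assms(2)] by auto
qed

lemma H2_deriv2_add:
  assumes "H2_deriv2 l u g" "H2_deriv2 l u' g'"
  shows "H2_deriv2 l (\<lambda>x. u x + u' x) (\<lambda>x. g x + g' x)"
proof -
  obtain v v' where v: "\<forall>x\<in>{0..l}. (u has_vector_derivative v x) (at x within {0..l})
        \<and> (g has_integral (v x - v 0)) {0..x}"
      "\<forall>x\<in>{0..l}. (u' has_vector_derivative v' x) (at x within {0..l})
        \<and> (g' has_integral (v' x - v' 0)) {0..x}"
    using assms by (auto simp: H2_deriv2_def)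
  have "((\<lambda>x. u x + u' x) has_vector_derivative v x + v' x) (at x within {0..l})"
    if "x \<in> {0..l}" for x
    using v that by (intro has_vector_derivative_add) auto
  moreover have "((\<lambda>x. g x + g' x) has_integral (v x + v' x - (v 0 + v' 0))) {0..x}" if "x \<in> {0..l}" for x
    using v that has_integral_add[of g "v x - v 0" "{0..x}" g' "v' x - v' 0"]
    by (auto simp: algebra_simps)
  ultimately show ?thesis
    using assms L2_on_add[of l g g'] unfolding H2_deriv2_def
    by (intro conjI exI[of _ "\<lambda>x. v x + v' x"]) auto
qed

lemma H2_deriv2_cmult:
  assumes "H2_deriv2 l u g"
  shows "H2_deriv2 l (\<lambda>x. c * u x) (\<lambda>x. c * g x)"
proof -
  obtain v where v: "\<forall>x\<in>{0..l}. (u has_vector_derivative v x) (at x within {0..l})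
        \<and> (g has_integral (v x - v 0)) {0..x}"
    using assms by (auto simp: H2_deriv2_def)
  have "((\<lambda>x. c * u x) has_vector_derivative c * v x) (at x within {0..l})
      \<and> ((\<lambda>x. c * g x) has_integral (c * v x - c * v 0)) {0..x}" if "x \<in> {0..l}" for x
    using v that has_integral_mult_right[of g "v x - v 0" "{0..x}" c]
    by (auto intro!: derivative_eq_intros simp: algebra_simps)
  then show ?thesis
    using assms L2_on_cmult[of l g c] unfolding H2_deriv2_def
    by (intro conjI exI[of _ "\<lambda>x. c * v x"]) auto
qed

lemma H2_deriv2_has_derivative:
  assumes l: "l > 0" and u: "H2_deriv2 l u g" and x: "x \<in> {0..l}"
  shows "(u has_vector_derivative vector_derivative u (at x within {0..l})) (at x within {0..l})"
proof -
  have "\<exists>d. (u has_vector_derivative d) (at x within {0..l})"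
    using u x unfolding H2_deriv2_def by blast
  then obtain d where "(u has_vector_derivative d) (at x within {0..l})" ..
  then show ?thesis
    using vector_derivative_within_closed_interval[OF l x] by metis
qed

lemma H2_deriv2_classical:
  assumes d: "\<And>x. x \<in> {0..l} \<Longrightarrow> (u has_vector_derivative v x) (at x within {0..l})"
    "\<And>x. x \<in> {0..l} \<Longrightarrow> (v has_vector_derivative g x) (at x within {0..l})"
    and g: "continuous_on {0..l} g"
  shows "H2_deriv2 l u g"
proof -
  have "(g has_integral (v x - v 0)) {0..x}" if "x \<in> {0..l}" for x
    using that by (intro fundamental_theorem_of_calculus)
      (auto intro: has_vector_derivative_within_subset[OF d(2)])
  then show ?thesis
    using d(1) L2_on_continuous[OF g] unfolding H2_deriv2_def by blast
qed

lemma has_vector_derivative_imp_continuous_on: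
  assumes "\<And>x. x \<in> S \<Longrightarrow> (f has_vector_derivative f' x) (at x within S)"
  shows "continuous_on S f"
  using assms by (meson continuous_on_vector_derivative)

text \<open>Regularity: the weak second derivative is \<open>c * u\<close>, which is continuous
  because \<open>u\<close> is differentiable. So the derivative of \<open>u\<close> is a primitive
  of a continuous function and the equation holds classically.\<close>

lemma H2_deriv2_eigen:
  assumes l: "l > 0" and u: "H2_deriv2 l u (\<lambda>x. c * u x)" and x: "x \<in> {0..l}"
  shows "((\<lambda>x. vector_derivative u (at x within {0..l})) has_vector_derivative c * u x)
    (at x within {0..l})"
proof -
  obtain v where v: "\<And>x. x \<in> {0..l} \<Longrightarrow> (u has_vector_derivative v x) (at x within {0..l})"
      "\<And>x. x \<in> {0..l} \<Longrightarrow> ((\<lambda>x. c * u x) has_integral (v x - v 0)) {0..x}"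
    using u unfolding H2_deriv2_def by blast
  have "continuous_on {0..l} (\<lambda>x. c * u x)"
    by (intro continuous_intros has_vector_derivative_imp_continuous_on[OF v(1)])
  from has_vector_derivative_add[OF has_vector_derivative_const integral_has_vector_derivative[OF this x]]
  have "((\<lambda>x. v 0 + integral {0..x} (\<lambda>x. c * u x)) has_vector_derivative c * u x) (at x within {0..l})"
    by simp
  moreover have "vector_derivative u (at y within {0..l}) = v 0 + integral {0..y} (\<lambda>x. c * u x)"
    if "y \<in> {0..l}" for y
    using vector_derivative_within_closed_interval[OF l that v(1)[OF that]]
      integral_unique[OF v(2)[OF that]] by simp
  ultimately show ?thesis
    using x by (subst has_vector_derivative_cong_ev[where g = "\<lambda>x. v 0 + integral {0..x} (\<lambda>x. c * u x)"])
      (auto simp: eventually_at_filter)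
qed

text \<open>Used for teeth that have to be traversed from the leaf towards the polygon.\<close>

lemma has_vector_derivative_reflect:
  fixes f :: "real \<Rightarrow> complex"
  assumes "\<And>x. x \<in> {0..l} \<Longrightarrow> (f has_vector_derivative f' x) (at x within {0..l})" "x \<in> {0..l}"
  shows "((\<lambda>x. f (l - x)) has_vector_derivative - f' (l - x)) (at x within {0..l})"
proof -
  have im: "(\<lambda>x. l - x) ` {0..l} = {0..l}"
    by (auto simp: image_iff intro!: bexI[of _ "l - _"])
  have "((\<lambda>x. l - x) has_vector_derivative - 1) (at x within {0..l})"
    by (auto intro!: derivative_eq_intros)
  moreover have "(f has_vector_derivative f' (l - x)) (at (l - x) within (\<lambda>x. l - x) ` {0..l})"
    unfolding im using assms by auto
  ultimately show ?thesis
    using vector_diff_chain_within[of "\<lambda>x. l - x" "-1" x "{0..l}" f "f' (l - x)"]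
    by (simp add: o_def)
qed

lemma has_vector_derivative_cos_sin:
  fixes k :: complex
  shows "((\<lambda>x. cos (k * of_real x)) has_vector_derivative - (k * sin (k * of_real x))) (at x within S)"
    and "((\<lambda>x. sin (k * of_real x)) has_vector_derivative k * cos (k * of_real x)) (at x within S)"
proof -
  have k: "((\<lambda>x. k * of_real x) has_vector_derivative k) (at x within S)"
    by (auto intro!: derivative_eq_intros)
  have "(cos has_field_derivative - sin (k * of_real x)) (at (k * of_real x) within T)"
    "(sin has_field_derivative cos (k * of_real x)) (at (k * of_real x) within T)" for T
    by (auto intro!: derivative_eq_intros)
  from field_vector_diff_chain_within[OF k this(1)] field_vector_diff_chain_within[OF k this(2)]
  show "((\<lambda>x. cos (k * of_real x)) has_vector_derivative - (k * sin (k * of_real x))) (at x within S)"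
    "((\<lambda>x. sin (k * of_real x)) has_vector_derivative k * cos (k * of_real x)) (at x within S)"
    by (simp_all add: o_def)
qed

text \<open>
  For merely square integrable \<open>f\<close> the variation-of-constants formula is applied to the primitive
  \<open>F\<close> of \<open>f\<close>: if \<open>U'' + k\<^sup>2 U = - F\<close> classically then \<open>p = U'\<close> solves \<open>p'' + k\<^sup>2 p = - f\<close>, with
  \<open>p' = - F - k\<^sup>2 U\<close>.
\<close>

lemma particular_solution:
  fixes k :: complex
  assumes l: "l > 0" and k: "k \<noteq> 0"
  shows "\<exists>K\<ge>0. \<forall>f. L2_on l f \<longrightarrow> (\<exists>p. H2_deriv2 l p (\<lambda>x. - (f x + k\<^sup>2 * p x)) \<and>
    (\<forall>x\<in>{0..l}. cmod (p x) \<le> K * L2_norm_on l f \<and>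
       cmod (vector_derivative p (at x within {0..l})) \<le> K * L2_norm_on l f))"
proof -
  let ?c = "\<lambda>x::real. cos (k * of_real x)" and ?s = "\<lambda>x::real. sin (k * of_real x)"
  have cc: "continuous_on {0..l} ?c" and cs: "continuous_on {0..l} ?s"
    by (intro continuous_intros)+
  obtain M1 M2 where M12: "\<And>x. x \<in> {0..l} \<Longrightarrow> cmod (?c x) \<le> M1" "\<And>x. x \<in> {0..l} \<Longrightarrow> cmod (?s x) \<le> M2"
    using continuous_on_compact_bound[OF compact_Icc cc] continuous_on_compact_bound[OF compact_Icc cs] by metis
  define M where "M = max M1 M2"
  have M: "cmod (?c x) \<le> M" "cmod (?s x) \<le> M" if "x \<in> {0..l}" for x
    using M12[OF that] by (auto simp: M_def)
  have M0: "0 \<le> M" using M(1)[of 0] norm_ge_zero[of "?c 0"] l by (auto intro: order_trans simp del: norm_ge_zero)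
  \<comment> \<open>With N = \<open>sqrt l * L2_norm_on l f\<close> bounding the primitive of
    \<open>f\<close>, the integrals \<open>A\<close> and \<open>B\<close> below are at most M N l,
    so the solution is at most 2 M (M N l), and its derivative at most N plus \<open>cmod k\<close>
    times the same quantity. \<open>K\<close> dominates both.\<close>
  define K where "K = sqrt l * (1 + 2 * M * M * l * (1 + cmod k))"
  have K0: "0 \<le> K" using M0 l by (simp add: K_def)
  have "\<exists>p. H2_deriv2 l p (\<lambda>x. - (f x + k\<^sup>2 * p x)) \<and>
    (\<forall>x\<in>{0..l}. cmod (p x) \<le> K * L2_norm_on l f \<and>
       cmod (vector_derivative p (at x within {0..l})) \<le> K * L2_norm_on l f)" if f: "L2_on l f" for f
  proof -
    define N where "N = sqrt l * L2_norm_on l f"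
    have N0: "0 \<le> N" using l by (simp add: N_def L2_norm_on_nonneg)
    define F where "F = (\<lambda>x. integral {0..x} f)"
    have Fc: "continuous_on {0..l} F"
      unfolding F_def by (rule L2_on_primitive_continuous[OF f])
    have FN: "cmod (F x) \<le> N" if "x \<in> {0..l}" for x
      unfolding F_def N_def by (rule L2_on_primitive(2)[OF l f that])
    define A where "A = (\<lambda>x. integral {0..x} (\<lambda>t. ?c t * F t))"
    define B where "B = (\<lambda>x. integral {0..x} (\<lambda>t. ?s t * F t))"
    have cA: "continuous_on {0..l} (\<lambda>t. ?c t * F t)" and cB: "continuous_on {0..l} (\<lambda>t. ?s t * F t)"
      by (intro continuous_intros Fc)+
    have A': "(A has_vector_derivative ?c x * F x) (at x within {0..l})"
      and B': "(B has_vector_derivative ?s x * F x) (at x within {0..l})" if "x \<in> {0..l}" for x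
      unfolding A_def B_def
      by (rule integral_has_vector_derivative[OF cA that] integral_has_vector_derivative[OF cB that])+
    have bound: "cmod (integral {0..x} (\<lambda>t. h t * F t)) \<le> M * N * l"
      if x: "x \<in> {0..l}" and h: "continuous_on {0..l} h" "\<And>x. x \<in> {0..l} \<Longrightarrow> cmod (h x) \<le> M" for x h
    proof -
      have "cmod (integral {0..x} (\<lambda>t. h t * F t)) \<le> M * N * (x - 0)"
        using x M0 N0
        by (intro integral_bound continuous_on_mult continuous_on_subset[OF h(1)] continuous_on_subset[OF Fc])
          (auto simp: norm_mult intro!: mult_mono h FN)
      also have "\<dots> \<le> M * N * l"
        using x M0 N0 by (intro mult_left_mono) auto
      finally show ?thesis .
    qed
    have AB: "cmod (A x) \<le> M * N * l" "cmod (B x) \<le> M * N * l" if "x \<in> {0..l}" for x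
      unfolding A_def B_def by (rule bound[OF that cc M(1)] bound[OF that cs M(2)]; assumption)+
    \<comment> \<open>Variation of constants: \<open>U x\<close> is -1/k times the integral of sin
      (k (x - t)) F t over {0..x}. The addition theorem splits off the dependence on x, which leaves
      the ordinary primitives \<open>A\<close> and \<open>B\<close> and makes \<open>U\<close>
      differentiable by the product rule.\<close>
    define U where "U = (\<lambda>x. - (?s x * A x - ?c x * B x) / k)"
    define p where "p = (\<lambda>x. - (?c x * A x + ?s x * B x))"
    define v where "v = (\<lambda>x. - F x - k\<^sup>2 * U x)"
    have one: "?c x * ?c x + ?s x * ?s x = 1" for x
      using sin_cos_squared_add3[of "k * of_real x"] by simp
    have U': "(U has_vector_derivative p x) (at x within {0..l})" if x: "x \<in> {0..l}" for x
    proof -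
      have "((\<lambda>x. (- (1 / k)) * (?s x * A x - ?c x * B x)) has_vector_derivative (- (1 / k)) *
          ((?s x * (?c x * F x) + k * ?c x * A x) - (?c x * (?s x * F x) + - (k * ?s x) * B x))) (at x within {0..l})"
        by (intro has_vector_derivative_mult_right has_vector_derivative_diff has_vector_derivative_mult
          has_vector_derivative_cos_sin A' B' x)
      moreover have "(- (1 / k)) * ((?s x * (?c x * F x) + k * ?c x * A x) - (?c x * (?s x * F x) + - (k * ?s x) * B x)) = p x"
        using k by (simp add: p_def field_simps)
      moreover have "U = (\<lambda>x. (- (1 / k)) * (?s x * A x - ?c x * B x))"
        by (simp add: U_def fun_eq_iff diff_divide_distrib)
      ultimately show ?thesis by simp
    qed
    have p': "(p has_vector_derivative v x) (at x within {0..l})" if x: "x \<in> {0..l}" for x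
    proof -
      have "(p has_vector_derivative - ((?c x * (?c x * F x) + - (k * ?s x) * A x)
          + (?s x * (?s x * F x) + k * ?c x * B x))) (at x within {0..l})"
        unfolding p_def by (intro has_vector_derivative_minus has_vector_derivative_add has_vector_derivative_mult
          has_vector_derivative_cos_sin A' B' x)
      moreover have "- ((?c x * (?c x * F x) + - (k * ?s x) * A x) + (?s x * (?s x * F x) + k * ?c x * B x))
        = - (?c x * ?c x + ?s x * ?s x) * F x + k * (?s x * A x - ?c x * B x)"
        by (simp add: algebra_simps
          del: sin_cos_squared_add sin_cos_squared_add2 sin_cos_squared_add3)
      moreover have "\<dots> = v x"
        unfolding one using k by (simp add: v_def U_def power2_eq_square field_simps)
      ultimately show ?thesis by (simp only:)
    qed
    have pc: "continuous_on {0..l} p"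
      using p' by (rule has_vector_derivative_imp_continuous_on)
    \<comment> \<open>\<open>F\<close> is the primitive of \<open>f\<close> and \<open>U\<close>
      that of \<open>p\<close>, so \<open>v\<close> is recovered by integrating the right-hand side;
      \<open>F\<close> itself is never differentiated.\<close>
    have "((\<lambda>t. - (f t + k\<^sup>2 * p t)) has_integral (v x - v 0)) {0..x}" if x: "x \<in> {0..l}" for x
    proof -
      have "(p has_integral (U x - U 0)) {0..x}"
        using x by (intro fundamental_theorem_of_calculus)
          (auto intro: has_vector_derivative_within_subset[OF U'])
      from has_integral_neg[OF has_integral_add[OF L2_on_primitive(1)[OF l f x] has_integral_mult_right[OF this, of "k\<^sup>2"]]]
      show ?thesis by (simp add: v_def F_def algebra_simps)
    qed
    moreover have "L2_on l (\<lambda>x. - (f x + k\<^sup>2 * p x))"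
      using L2_on_cmult[OF L2_on_add[OF f L2_on_cmult[OF L2_on_continuous[OF pc], of "k\<^sup>2"]], of "-1"] by simp
    ultimately have "H2_deriv2 l p (\<lambda>x. - (f x + k\<^sup>2 * p x))"
      unfolding H2_deriv2_def using p' by blast
    moreover have "cmod (p x) \<le> K * L2_norm_on l f \<and> cmod (vector_derivative p (at x within {0..l})) \<le> K * L2_norm_on l f"
      if x: "x \<in> {0..l}" for x
    proof
      have KN: "K * L2_norm_on l f = N + 2 * M * (M * N * l) * (1 + cmod k)"
        by (simp add: K_def N_def algebra_simps)
      have nn: "0 \<le> M * (M * N * l)" using M0 N0 l by simp
      have "cmod (p x) \<le> cmod (?c x * A x) + cmod (?s x * B x)"
        unfolding p_def norm_minus_cancel by (rule norm_triangle_ineq)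
      also have "\<dots> \<le> M * (M * N * l) + M * (M * N * l)"
        unfolding norm_mult by (intro add_mono mult_mono M AB x M0) auto
      also have "\<dots> \<le> K * L2_norm_on l f"
        using N0 nn mult_nonneg_nonneg[OF nn norm_ge_zero[of k]] unfolding KN by (simp add: algebra_simps)
      finally show "cmod (p x) \<le> K * L2_norm_on l f" .
      have "k\<^sup>2 * U x = - (k * (?s x * A x - ?c x * B x))"
        using k by (simp add: U_def power2_eq_square field_simps)
      then have "v x = - F x + k * (?s x * A x - ?c x * B x)" by (simp add: v_def)
      then have "cmod (v x) \<le> cmod (F x) + cmod (k * (?s x * A x - ?c x * B x))"
        by (metis norm_triangle_ineq norm_minus_cancel)
      also have "cmod (k * (?s x * A x - ?c x * B x)) \<le> cmod k * (cmod (?s x * A x) + cmod (?c x * B x))"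
        unfolding norm_mult[of k] by (intro mult_left_mono norm_triangle_ineq4) auto
      also have "\<dots> \<le> cmod k * (M * (M * N * l) + M * (M * N * l))"
        unfolding norm_mult by (intro mult_left_mono add_mono mult_mono M AB x M0) auto
      finally have "cmod (v x) \<le> N + cmod k * (M * (M * N * l) + M * (M * N * l))"
        using FN[OF x] by simp
      also have "\<dots> \<le> K * L2_norm_on l f"
        using nn unfolding KN by (simp add: algebra_simps)
      finally show "cmod (vector_derivative p (at x within {0..l})) \<le> K * L2_norm_on l f"
        using vector_derivative_within_closed_interval[OF l x p'[OF x]] by simp
    qed
    ultimately show ?thesis by blast
  qed
  with K0 show ?thesis by blast
qed

section \<open>Square linear systems\<close>

text \<open>An injective endomorphism of a finite-dimensional space is onto. The functions
  \<open>R j\<close> are preimages of the unit vectors, that is, the columns of a right inverse.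
  Having them fixed before \<open>r\<close> makes the solution linear in \<open>r\<close>, so that
  it can be bounded.\<close>

lemma finite_linear_inj_imp_surj:
  fixes T :: "('i \<Rightarrow> complex) \<Rightarrow> ('i \<Rightarrow> complex)"
  assumes S: "finite S"
    and lin: "\<And>a c d. T (\<lambda>x. c x + a * d x) = (\<lambda>x. T c x + a * T d x)"
    and inj: "\<And>c. \<forall>i\<in>S. T c i = 0 \<Longrightarrow> \<forall>i\<in>S. c i = 0"
  shows "\<exists>R. \<forall>r. \<forall>i\<in>S. T (\<lambda>m. \<Sum>j\<in>S. r j * R j m) i = r i"
proof -
  have T0: "T (\<lambda>x. 0) = (\<lambda>x. 0)"
    using lin[of "\<lambda>x. 0" "- 1" "\<lambda>x. 0"] by simp
  have add: "T (\<lambda>x. c x + d x) = (\<lambda>x. T c x + T d x)" for c d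
    using lin[of c 1 d] by simp
  have scale: "T (\<lambda>x. a * c x) = (\<lambda>x. a * T c x)" for a c
    using lin[of "\<lambda>x. 0" a c] by (simp add: T0)
  define sc :: "complex \<Rightarrow> ('i \<Rightarrow> complex) \<Rightarrow> ('i \<Rightarrow> complex)" where "sc = (\<lambda>a c x. a * c x)"
  interpret V: vector_space sc
    by unfold_locales (auto simp: sc_def fun_eq_iff algebra_simps)
  interpret P: vector_space_pair sc sc ..
  define \<delta> :: "'i \<Rightarrow> 'i \<Rightarrow> complex" where "\<delta> = (\<lambda>i x. if x = i then 1 else 0)"
  define pr :: "('i \<Rightarrow> complex) \<Rightarrow> ('i \<Rightarrow> complex)" where "pr = (\<lambda>c x. if x \<in> S then c x else 0)"
  \<comment> \<open>The full function space may be infinite-dimensional and \<open>T\<close> is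
    controlled only on \<open>S\<close>. Cutting off to \<open>S\<close> before and after gives an
    endomorphism of the span of the unit vectors \<open>\<delta> i\<close>.\<close>
  define T' where "T' = (\<lambda>c. pr (T (pr c)))"
  let ?B = "\<delta> ` S"
  have pr_add: "pr (\<lambda>x. c x + d x) = (\<lambda>x. pr c x + pr d x)" for c d by (auto simp: pr_def)
  have pr_scale: "pr (\<lambda>x. a * c x) = (\<lambda>x. a * pr c x)" for a c by (auto simp: pr_def)
  have linT: "Vector_Spaces.linear sc sc T'"
    unfolding Vector_Spaces.linear_iff using V.vector_space_axioms
    by (simp add: T'_def sc_def plus_fun_def pr_add pr_scale add scale)
  have sumc: "sum (\<lambda>j. sc (c j) (f j)) S x = (\<Sum>j\<in>S. c j * f j x)" for c f x
    using S by (induction rule: finite_induct) (auto simp: sc_def)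
  have spB: "pr c \<in> V.span ?B" for c
  proof -
    have "pr c = (\<Sum>j\<in>S. sc (c j) (\<delta> j))"
      using S by (intro ext) (simp add: sumc \<delta>_def pr_def if_distrib[of "\<lambda>x. _ * x"] cong: if_cong)
    moreover have "(\<Sum>j\<in>S. sc (c j) (\<delta> j)) \<in> V.span ?B"
      by (intro V.span_sum V.span_scale V.span_base) auto
    ultimately show ?thesis by simp
  qed
  have sub: "V.span ?B \<subseteq> {c. \<forall>x. x \<notin> S \<longrightarrow> c x = 0}"
    by (rule V.span_minimal; (intro V.subspaceI)?)
      (auto simp: pr_def \<delta>_def sc_def fun_eq_iff plus_fun_def zero_fun_def)
  have T'0: "c = 0" if "c \<in> V.span ?B" "T' c = 0" for c
  proof -
    have c: "pr c = c" using sub that by (fastforce simp: pr_def)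
    have "\<forall>i\<in>S. T c i = 0"
      using that(2) c unfolding T'_def by (auto simp: pr_def fun_eq_iff zero_fun_def split: if_splits)
    then have "\<forall>i\<in>S. c i = 0" by (rule inj)
    then have "pr c = 0" by (auto simp: pr_def)
    with c show ?thesis by simp
  qed
  have injT: "inj_on T' (V.span ?B)"
    using P.linear_inj_on_iff_eq_0[OF linT V.subspace_span] T'0 by blast
  have inj\<delta>: "inj_on \<delta> S"
    by (auto simp: inj_on_def \<delta>_def fun_eq_iff split: if_splits)
  have indB: "V.independent ?B"
  proof (rule V.independent_if_scalars_zero)
    fix u v assume 0: "(\<Sum>j\<in>?B. sc (u j) j) = 0" and v: "v \<in> ?B"
    then obtain i where i: "i \<in> S" "v = \<delta> i" by auto
    have "(\<Sum>j\<in>S. sc (u (\<delta> j)) (\<delta> j)) i = 0"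
      using 0 inj\<delta> by (simp add: sum.reindex)
    then show "u v = 0"
      using i S by (simp add: sumc) (simp add: \<delta>_def if_distrib[of "\<lambda>x. _ * x"] cong: if_cong)
  qed (use S in simp)
  have indT: "V.independent (T' ` ?B)"
    by (rule P.linear_independent_injective_image[OF linT indB injT])
  have cardT: "card (T' ` ?B) = card ?B"
    by (intro card_image inj_on_subset[OF injT] V.span_superset)
  have "\<delta> j \<in> V.span (T' ` ?B)" if j: "j \<in> S" for j
  proof (rule ccontr)
    \<comment> \<open>Exchange argument: one more unit vector outside the span of the image would
      give \<open>card ?B + 1\<close> independent vectors in a space spanned by
      \<open>card ?B\<close> vectors.\<close>
    assume n: "\<delta> j \<notin> V.span (T' ` ?B)"
    have i: "V.independent (insert (\<delta> j) (T' ` ?B))"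
      using indT n by (rule V.independent_insertI[rotated])
    have "insert (\<delta> j) (T' ` ?B) \<subseteq> V.span ?B"
      using j spB unfolding T'_def by (auto intro: V.span_base)
    from V.independent_span_bound[OF _ i this] S
    have "card (insert (\<delta> j) (T' ` ?B)) \<le> card ?B" by auto
    moreover have "\<delta> j \<notin> T' ` ?B" using n V.span_superset[of "T' ` ?B"] by (metis subsetD)
    ultimately show False using S cardT by (simp add: card_insert_if)
  qed
  then have "\<forall>j\<in>S. \<exists>c. \<delta> j = T' c"
    by (auto simp: P.linear_span_image[OF linT])
  then obtain C where C: "\<And>j. j \<in> S \<Longrightarrow> \<delta> j = T' (C j)" by metis
  define R where "R = (\<lambda>j. pr (C j))"
  have TR: "T (R j) i = \<delta> j i" if "i \<in> S" "j \<in> S" for i j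
    using fun_cong[OF C[OF that(2)], of i] that(1) unfolding T'_def R_def by (simp only: pr_def if_True)
  have Tsum: "T (\<lambda>m. \<Sum>j\<in>J. r j * R j m) = (\<lambda>i. \<Sum>j\<in>J. r j * T (R j) i)" if "finite J" for J r
    using that by (induction rule: finite_induct) (auto simp: T0 add scale)
  show ?thesis
  proof (intro exI allI ballI)
    fix r :: "'i \<Rightarrow> complex" and i assume i: "i \<in> S"
    then show "T (\<lambda>m. \<Sum>j\<in>S. r j * R j m) i = r i"
      using S TR by (simp add: Tsum[OF S]) (simp add: \<delta>_def if_distrib[of "\<lambda>x. _ * x"] cong: if_cong)
  qed
qed

section \<open>Solutions on the edges and vertex conditions\<close>

text \<open>The differential equation separated from the vertex conditions, so that particular
  solutions and waves can be superposed before the vertex conditions are imposed.\<close>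

definition solves_on_edges :: "gear \<Rightarrow> complex \<Rightarrow> edge_fun \<Rightarrow> edge_fun \<Rightarrow> bool" where
  "solves_on_edges G \<mu> f u \<longleftrightarrow>
     (\<forall>e x. e \<notin> edges G \<or> x \<notin> {0..elen G e} \<longrightarrow> u e x = 0)
     \<and> (\<forall>e\<in>edges G. H2_deriv2 (elen G e) (u e) (\<lambda>x. - (f e x + \<mu> * u e x)))"

text \<open>
  There are as many scalar vertex conditions as there are free coefficients in the general solution
  (two for each edge), and both are indexed by \<open>edges G \<times> UNIV\<close>.
\<close>

fun vertex_defect :: "real \<Rightarrow> gear \<Rightarrow> edge_fun \<Rightarrow> edge \<times> bool \<Rightarrow> complex" where
  "vertex_defect w G u (Side i, False) = u (Side i) (len G i) - u (Side (nxt G i)) 0"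
| "vertex_defect w G u (Tooth i, False) = u (Tooth i) 0 - u (Side (att G i)) 0"
| "vertex_defect w G u (Side v, True) =
     edge_deriv G u (Side v) 0
     + (\<Sum>i | i < sides G \<and> nxt G i = v. - edge_deriv G u (Side i) (len G i))
     + of_real w * (\<Sum>i | i < sides G \<and> att G i = v. edge_deriv G u (Tooth i) 0)"
| "vertex_defect w G u (Tooth i, True) = edge_deriv G u (Tooth i) (len G i)"

definition wave :: "gear \<Rightarrow> complex \<Rightarrow> (edge \<times> bool \<Rightarrow> complex) \<Rightarrow> edge_fun" where
  "wave G k c e x = (if e \<in> edges G \<and> x \<in> {0..elen G e}
     then c (e, False) * cos (k * of_real x) + c (e, True) * sin (k * of_real x) else 0)"

lemma wave_linear:
  "wave G k (\<lambda>i. c i + a * d i) = (\<lambda>e x. wave G k c e x + a * wave G k d e x)"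
  by (auto simp: wave_def fun_eq_iff algebra_simps)

lemma finite_edges: "finite (edges G)"
  by (simp add: edges_def)

lemma edges_iff [simp]: "Side i \<in> edges G \<longleftrightarrow> i < sides G" "Tooth i \<in> edges G \<longleftrightarrow> i < sides G"
  by (auto simp: edges_def)

lemma Ball_edges_bool:
  "(\<forall>j\<in>edges G \<times> UNIV. P j) \<longleftrightarrow> (\<forall>i<sides G. P (Side i, False) \<and> P (Tooth i, False) \<and>
     P (Side i, True) \<and> P (Tooth i, True))"
  by (auto simp: edges_def UNIV_bool)

section \<open>Linearity of edge derivatives and vertex defects\<close>

locale weighted_gear =
  fixes n :: nat and l :: "nat \<Rightarrow> real" and G :: gear and w :: real
  assumes n: "n \<ge> 3"
    and l: "\<And>i. i < n \<Longrightarrow> l i > 0"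
    and gear: "is_gear n l G"
    and w: "w > 0"
begin

lemma sides [simp]: "sides G = n"
  using gear by (simp add: is_gear_def)

lemma len [simp]: "i < n \<Longrightarrow> len G i = l i"
  using gear by (simp add: is_gear_def)

lemma att: "i < n \<Longrightarrow> att G i = i \<or> att G i = nxt G i"
  using gear by (auto simp: is_gear_def)

lemma nxt_less [simp]: "nxt G i < n"
  using n by (simp add: nxt_def)

lemma att_less [simp]: "i < n \<Longrightarrow> att G i < n"
  using att by fastforce

lemma elen_pos: "e \<in> edges G \<Longrightarrow> elen G e > 0"
  using l by (auto simp: edges_def)

lemma has_edge_deriv:
  assumes "solves_on_edges G \<mu> f u" "e \<in> edges G" "x \<in> {0..elen G e}"
  shows "(u e has_vector_derivative edge_deriv G u e x) (at x within {0..elen G e})"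
  using assms H2_deriv2_has_derivative[OF elen_pos] by (auto simp: solves_on_edges_def edge_deriv_def)

lemma edge_deriv_eq:
  assumes "e \<in> edges G" "x \<in> {0..elen G e}"
    and "(u e has_vector_derivative d) (at x within {0..elen G e})"
  shows "edge_deriv G u e x = d"
  unfolding edge_deriv_def
  by (rule vector_derivative_within_closed_interval[OF elen_pos]) (use assms in auto)

text \<open>\<open>vector_derivative\<close> is a choice operator and behaves linearly only where
  derivatives exist; this is why linearity is stated for solutions on the edges. The two equations
  may have different parameters and right-hand sides.\<close>

lemma edge_deriv_linear:
  assumes "solves_on_edges G \<mu> f u" "solves_on_edges G \<nu> g v" "e \<in> edges G" "x \<in> {0..elen G e}"
  shows "edge_deriv G (\<lambda>e x. u e x + a * v e x) e x = edge_deriv G u e x + a * edge_deriv G v e x"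
  using assms by (intro edge_deriv_eq has_vector_derivative_add has_vector_derivative_mult_right has_edge_deriv)

lemma vertex_defect_linear:
  assumes u: "solves_on_edges G \<mu> f u" and v: "solves_on_edges G \<nu> g v" and j: "j \<in> edges G \<times> UNIV"
  shows "vertex_defect w G (\<lambda>e x. u e x + a * v e x) j = vertex_defect w G u j + a * vertex_defect w G v j"
proof -
  have d: "edge_deriv G (\<lambda>e x. u e x + a * v e x) (Side i) 0
        = edge_deriv G u (Side i) 0 + a * edge_deriv G v (Side i) 0"
      "edge_deriv G (\<lambda>e x. u e x + a * v e x) (Tooth i) 0
        = edge_deriv G u (Tooth i) 0 + a * edge_deriv G v (Tooth i) 0"
      "edge_deriv G (\<lambda>e x. u e x + a * v e x) (Side i) (l i)
        = edge_deriv G u (Side i) (l i) + a * edge_deriv G v (Side i) (l i)"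
      "edge_deriv G (\<lambda>e x. u e x + a * v e x) (Tooth i) (l i)
        = edge_deriv G u (Tooth i) (l i) + a * edge_deriv G v (Tooth i) (l i)" if "i < n" for i
    using that less_imp_le[OF l[OF that]] by (auto intro!: edge_deriv_linear[OF u v])
  have s: "(\<Sum>i | i < n \<and> nxt G i = q. - edge_deriv G (\<lambda>e x. u e x + a * v e x) (Side i) (len G i))
      = (\<Sum>i | i < n \<and> nxt G i = q. - edge_deriv G u (Side i) (len G i))
        + a * (\<Sum>i | i < n \<and> nxt G i = q. - edge_deriv G v (Side i) (len G i))"
    "(\<Sum>i | i < n \<and> att G i = q. edge_deriv G (\<lambda>e x. u e x + a * v e x) (Tooth i) 0)
      = (\<Sum>i | i < n \<and> att G i = q. edge_deriv G u (Tooth i) 0)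
        + a * (\<Sum>i | i < n \<and> att G i = q. edge_deriv G v (Tooth i) 0)" for q
    unfolding sum_distrib_left sum.distrib[symmetric]
    by (auto intro!: sum.cong simp: d algebra_simps)
  have kirch: "vertex_defect w G (\<lambda>e x. u e x + a * v e x) (Side i, True)
      = vertex_defect w G u (Side i, True) + a * vertex_defect w G v (Side i, True)" if "i < n" for i
    unfolding vertex_defect.simps sides s d(1)[OF that] by (simp only: algebra_simps)
  have "\<forall>j\<in>edges G \<times> UNIV. vertex_defect w G (\<lambda>e x. u e x + a * v e x) j
      = vertex_defect w G u j + a * vertex_defect w G v j"
    unfolding Ball_edges_bool using kirch by (simp add: d del: vertex_defect.simps(3)) (simp add: algebra_simps)
  with j show ?thesis by blast
qed

lemma solves_on_edges_linear:
  assumes "solves_on_edges G \<mu> f u" "solves_on_edges G \<mu> g v"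
  shows "solves_on_edges G \<mu> (\<lambda>e x. f e x + a * g e x) (\<lambda>e x. u e x + a * v e x)"
proof -
  have "H2_deriv2 (elen G e) (\<lambda>x. u e x + a * v e x)
      (\<lambda>x. - (f e x + a * g e x + \<mu> * (u e x + a * v e x)))" if "e \<in> edges G" for e
  proof -
    have "H2_deriv2 (elen G e) (\<lambda>x. u e x + a * v e x)
        (\<lambda>x. - (f e x + \<mu> * u e x) + a * - (g e x + \<mu> * v e x))"
      using assms that by (intro H2_deriv2_add H2_deriv2_cmult) (auto simp: solves_on_edges_def)
    then show ?thesis by (simp add: algebra_simps)
  qed
  with assms show ?thesis by (auto simp: solves_on_edges_def)
qed

lemma solves_on_edges_wave: "solves_on_edges G (k\<^sup>2) (\<lambda>e x. 0) (wave G k c)"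
proof -
  have "H2_deriv2 (elen G e) (wave G k c e) (\<lambda>x. - (0 + k\<^sup>2 * wave G k c e x))" if e: "e \<in> edges G" for e
  proof -
    let ?f = "\<lambda>x::real. c (e, False) * cos (k * of_real x) + c (e, True) * sin (k * of_real x)"
    have "H2_deriv2 (elen G e) ?f (\<lambda>x. - (k\<^sup>2 * ?f x))"
    proof (rule H2_deriv2_classical)
      fix x
      show "(?f has_vector_derivative c (e, False) * - (k * sin (k * of_real x))
          + c (e, True) * (k * cos (k * of_real x))) (at x within {0..elen G e})"
        by (intro has_vector_derivative_add has_vector_derivative_mult_right has_vector_derivative_cos_sin)
      have "((\<lambda>x. (- (c (e, False) * k)) * sin (k * of_real x) + (c (e, True) * k) * cos (k * of_real x))
          has_vector_derivative (- (c (e, False) * k)) * (k * cos (k * of_real x))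
            + (c (e, True) * k) * - (k * sin (k * of_real x))) (at x within {0..elen G e})"
        by (intro has_vector_derivative_add has_vector_derivative_mult_right has_vector_derivative_cos_sin)
      then show "((\<lambda>x. c (e, False) * - (k * sin (k * of_real x)) + c (e, True) * (k * cos (k * of_real x)))
          has_vector_derivative - (k\<^sup>2 * ?f x)) (at x within {0..elen G e})"
        by (simp add: algebra_simps power2_eq_square)
    qed (intro continuous_intros)
    then show ?thesis
      by (rule H2_deriv2_cong[THEN iffD1, rotated 2]) (use e in \<open>auto simp: wave_def\<close>)
  qed
  then show ?thesis by (auto simp: solves_on_edges_def wave_def)
qed

text \<open>Every vertex \<open>i\<close> is the start of \<open>Side i\<close>, so the
  existentially quantified vertex value can be read off there. This turns continuity into two scalar
  equations per index.\<close>

lemma laplacian_iff: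
  "laplacian w G u (\<lambda>e x. f e x + \<mu> * u e x) \<longleftrightarrow>
     solves_on_edges G \<mu> f u \<and> (\<forall>j\<in>edges G \<times> UNIV. vertex_defect w G u j = 0)"
proof -
  have "continuous_at_vertices G u \<longleftrightarrow>
      (\<forall>i<n. u (Side i) (len G i) = u (Side (nxt G i)) 0 \<and> u (Tooth i) 0 = u (Side (att G i)) 0)"
    (is "?L \<longleftrightarrow> ?R")
  proof
    assume ?L
    then show ?R unfolding continuous_at_vertices_def by (metis att_less nxt_less sides)
  next
    assume ?R
    then show ?L unfolding continuous_at_vertices_def by (intro exI[of _ "\<lambda>i. u (Side i) 0"]) auto
  qed
  then have "continuous_at_vertices G u \<and> weighted_kirchhoff w G u \<and> leaf_neumann G u \<longleftrightarrow>
      (\<forall>j\<in>edges G \<times> UNIV. vertex_defect w G u j = 0)"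
    unfolding Ball_edges_bool vertex_defect.simps weighted_kirchhoff_def leaf_neumann_def sides
      right_minus_eq by blast
  then show ?thesis
    unfolding laplacian_def lap_domain_def solves_on_edges_def H2_on_def mem_Collect_eq by blast
qed

lemma eigenspace_iff:
  "u \<in> eigenspace w G \<mu> \<longleftrightarrow>
     solves_on_edges G \<mu> (\<lambda>e x. 0) u \<and> (\<forall>j\<in>edges G \<times> UNIV. vertex_defect w G u j = 0)"
  using laplacian_iff[of u "\<lambda>e x. 0" \<mu>] by (simp add: eigenspace_def)

lemma zero_in_eigenspace: "(\<lambda>e x. 0) \<in> eigenspace w G \<mu>"
proof -
  have "H2_deriv2 (elen G e) (\<lambda>x. 0) (\<lambda>x. 0)" for e
    by (rule H2_deriv2_classical[where v = "\<lambda>x. 0"]) auto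
  moreover have "edge_deriv G (\<lambda>e x. 0) e x = 0" if "e \<in> edges G" "x \<in> {0..elen G e}" for e x
    using that by (intro edge_deriv_eq) auto
  then have "\<forall>j\<in>edges G \<times> UNIV. vertex_defect w G (\<lambda>e x. 0) j = 0"
    unfolding Ball_edges_bool using less_imp_le[OF l] by (auto intro!: sum.neutral)
  ultimately show ?thesis
    by (auto simp: eigenspace_iff solves_on_edges_def)
qed

lemma eigenspace_linear:
  assumes "u \<in> eigenspace w G \<mu>" "v \<in> eigenspace w G \<mu>"
  shows "(\<lambda>e x. u e x + a * v e x) \<in> eigenspace w G \<mu>"
  using assms solves_on_edges_linear[of \<mu> "\<lambda>e x. 0" u "\<lambda>e x. 0" v a] vertex_defect_linear
  unfolding eigenspace_iff by auto

lemma diff_in_eigenspace: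
  assumes "laplacian w G u (\<lambda>e x. f e x + \<mu> * u e x)" "laplacian w G v (\<lambda>e x. f e x + \<mu> * v e x)"
  shows "(\<lambda>e x. u e x + (- 1) * v e x) \<in> eigenspace w G \<mu>"
  using assms solves_on_edges_linear[of \<mu> f u f v "- 1"] vertex_defect_linear[where a = "- 1"]
  unfolding eigenspace_iff laplacian_iff by auto

lemma resolvent_imp_trivial_eigenspace:
  assumes "\<mu> \<in> resolvent_set w G" "u \<in> eigenspace w G \<mu>"
  shows "u = (\<lambda>e x. 0)"
proof -
  have "(\<lambda>e x. 0) \<in> L2_graph G"
    by (auto simp: L2_graph_def intro!: L2_on_continuous)
  moreover have "\<forall>f\<in>L2_graph G. \<exists>!u. laplacian w G u (\<lambda>e x. f e x + \<mu> * u e x)"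
    using assms(1) unfolding resolvent_set_def mem_Collect_eq by (rule conjunct1)
  ultimately have "\<exists>!u. laplacian w G u (\<lambda>e x. 0 + \<mu> * u e x)"
    by (rule bspec[rotated])
  then show ?thesis
    using assms(2) zero_in_eigenspace[of \<mu>] unfolding eigenspace_def by auto
qed

section \<open>The resolvent set\<close>

text \<open>The value at 0 is the cosine coefficient and the derivative at 0 is \<open>k\<close>
  times the sine coefficient. Here \<open>k \<noteq> 0\<close> enters.\<close>

lemma wave_inj:
  assumes k: "k \<noteq> 0" and z: "wave G k c = (\<lambda>e x. 0)" and j: "j \<in> edges G \<times> UNIV"
  shows "c j = 0"
proof -
  obtain e b where jb: "j = (e, b)" and e: "e \<in> edges G" using j by auto
  note L = elen_pos[OF e]
  have h: "c (e, False) * cos (k * of_real x) + c (e, True) * sin (k * of_real x) = 0"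
    if "x \<in> {0..elen G e}" for x
    using fun_cong[OF fun_cong[OF z], of e x] that e by (simp add: wave_def)
  have c0: "c (e, False) = 0" using h[of 0] L by simp
  have d: "((\<lambda>x. c (e, True) * sin (k * of_real x)) has_vector_derivative c (e, True) * (k * cos (k * of_real 0)))
      (at 0 within {0..elen G e})"
    by (intro has_vector_derivative_mult_right has_vector_derivative_cos_sin)
  have d0: "((\<lambda>x. c (e, True) * sin (k * of_real x)) has_vector_derivative 0) (at 0 within {0..elen G e})"
    using h c0 L
    by (subst has_vector_derivative_cong_ev[where g = "\<lambda>x. 0"]) (auto simp: eventually_at_filter)
  have "c (e, True) * (k * cos (k * of_real 0)) = 0"
    using vector_derivative_within_closed_interval[OF L _ d] vector_derivative_within_closed_interval[OF L _ d0] L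
    by auto
  then have "c (e, True) = 0" using k by simp
  with c0 jb show ?thesis by (cases b) auto
qed

text \<open>A wave without vertex defects is an eigenfunction. A trivial eigenspace therefore makes
  the map from coefficients to defects injective, hence onto because it is square.\<close>

lemma wave_vertex_defects_surj:
  assumes k: "k \<noteq> 0" and triv: "\<And>u. u \<in> eigenspace w G (k\<^sup>2) \<Longrightarrow> u = (\<lambda>e x. 0)"
  shows "\<exists>R. \<forall>r. \<forall>i\<in>edges G \<times> UNIV.
    vertex_defect w G (wave G k (\<lambda>m. \<Sum>j\<in>edges G \<times> UNIV. r j * R j m)) i = r i"
proof -
  let ?S = "edges G \<times> (UNIV :: bool set)"
  \<comment> \<open>Linearity of the defects is available only for indices of actual edges, whereas
    the linear algebra lemma asks for it at every index; hence the value 0 elsewhere.\<close>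
  define T where "T = (\<lambda>c i. if i \<in> ?S then vertex_defect w G (wave G k c) i else 0)"
  have "\<exists>R. \<forall>r. \<forall>i\<in>?S. T (\<lambda>m. \<Sum>j\<in>?S. r j * R j m) i = r i"
  proof (rule finite_linear_inj_imp_surj)
    show "finite ?S" by (simp add: finite_edges)
    show "T (\<lambda>x. c x + a * d x) = (\<lambda>x. T c x + a * T d x)" for a c d
      unfolding T_def wave_linear
      using vertex_defect_linear[OF solves_on_edges_wave solves_on_edges_wave] by fastforce
    fix c assume "\<forall>i\<in>?S. T c i = 0"
    then have "wave G k c \<in> eigenspace w G (k\<^sup>2)"
      using solves_on_edges_wave by (auto simp: eigenspace_iff T_def)
    then have "wave G k c = (\<lambda>e x. 0)" by (rule triv)
    then show "\<forall>i\<in>?S. c i = 0"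
      using wave_inj[OF k] by blast
  qed
  then show ?thesis by (simp add: T_def)
qed

section \<open>Norm estimates and solvability\<close>

text \<open>The factor is the square root of the total weighted length of the graph, teeth being
  counted with weight \<open>w\<close>.\<close>

lemma L2_graph_norm_le:
  assumes u: "\<And>e. e \<in> edges G \<Longrightarrow> L2_on (elen G e) (u e)"
    and b: "\<And>e x. e \<in> edges G \<Longrightarrow> x \<in> {0..elen G e} \<Longrightarrow> cmod (u e x) \<le> b" and b0: "b \<ge> 0"
  shows "L2_graph_norm w G u \<le> sqrt (\<Sum>i<n. l i * (1 + w)) * b"
proof -
  have e: "integral\<^sup>L (lebesgue_on {0..elen G e}) (\<lambda>x. (cmod (u e x))\<^sup>2) \<le> elen G e * b\<^sup>2"
    if "e \<in> edges G" for e
    using that by (intro integral_norm_squared_le_bound elen_pos u b)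
  have "L2_graph_norm w G u \<le> sqrt (\<Sum>i<n. l i * b\<^sup>2 + w * (l i * b\<^sup>2))"
    unfolding L2_graph_norm_def sides using e[of "Side _"] e[of "Tooth _"] w
    by (intro real_sqrt_le_mono sum_mono add_mono mult_left_mono) auto
  also have "(\<Sum>i<n. l i * b\<^sup>2 + w * (l i * b\<^sup>2)) = (\<Sum>i<n. l i * (1 + w)) * b\<^sup>2"
    by (simp add: sum_distrib_left sum_distrib_right algebra_simps)
  also have "sqrt \<dots> = sqrt (\<Sum>i<n. l i * (1 + w)) * b"
    using b0 by (simp add: real_sqrt_mult)
  finally show ?thesis .
qed

text \<open>Teeth contribute to the squared graph norm with weight \<open>w\<close>, so isolating
  one costs a factor \<open>1 / sqrt w\<close>; the summand 1 covers the sides.\<close>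

lemma L2_norm_on_le_graph_norm:
  assumes e: "e \<in> edges G"
  shows "L2_norm_on (elen G e) (f e) \<le> (1 + 1 / sqrt w) * L2_graph_norm w G f"
proof -
  define I where "I = (\<lambda>e. integral\<^sup>L (lebesgue_on {0..elen G e}) (\<lambda>x. (cmod (f e x))\<^sup>2))"
  have I0: "0 \<le> I e" for e by (simp add: I_def)
  define Q where "Q = (\<Sum>i<n. I (Side i) + w * I (Tooth i))"
  have N: "L2_graph_norm w G f = sqrt Q"
    by (simp add: L2_graph_norm_def Q_def I_def)
  have Q: "I (Side i) + w * I (Tooth i) \<le> Q" if "i < n" for i
    unfolding Q_def using that I0 w by (intro member_le_sum) auto
  have Q0: "0 \<le> Q" unfolding Q_def using I0 w by (intro sum_nonneg) auto
  have "I e \<le> Q \<or> I e \<le> Q / w"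
  proof (cases e)
    case (Side i)
    moreover have "0 \<le> w * I (Tooth i)" using w I0 by simp
    ultimately show ?thesis using Q[of i] e by simp
  next
    case (Tooth i)
    then show ?thesis using Q[of i] e I0[of "Side i"] w by (auto simp: field_simps)
  qed
  moreover have "0 \<le> sqrt Q" "0 \<le> sqrt Q / sqrt w"
    using Q0 w by simp_all
  ultimately have "sqrt (I e) \<le> sqrt Q + sqrt Q / sqrt w"
    using real_sqrt_le_mono[of "I e" Q] real_sqrt_le_mono[of "I e" "Q / w"]
    unfolding real_sqrt_divide by linarith
  then show ?thesis
    by (simp add: L2_norm_on_def N I_def algebra_simps)
qed

text \<open>The derivatives are bounded along with the values because the vertex defects, which the
  waves have to compensate, contain both.\<close>

lemma particular_solution_graph:
  assumes k: "k \<noteq> 0"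
  shows "\<exists>K\<ge>0. \<forall>f\<in>L2_graph G. \<exists>p. solves_on_edges G (k\<^sup>2) f p \<and>
    (\<forall>e\<in>edges G. \<forall>x\<in>{0..elen G e}. cmod (p e x) \<le> K * L2_graph_norm w G f \<and>
       cmod (edge_deriv G p e x) \<le> K * L2_graph_norm w G f)"
proof -
  define P where "P = (\<lambda>e K f p. H2_deriv2 (elen G e) p (\<lambda>x. - (f x + k\<^sup>2 * p x)) \<and>
      (\<forall>x\<in>{0..elen G e}. cmod (p x) \<le> K * L2_norm_on (elen G e) f \<and>
       cmod (vector_derivative p (at x within {0..elen G e})) \<le> K * L2_norm_on (elen G e) f))"
  have "\<forall>e\<in>edges G. \<exists>K\<ge>0. \<forall>f. L2_on (elen G e) f \<longrightarrow> (\<exists>p. P e K f p)"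
    unfolding P_def using particular_solution[OF elen_pos k] by (rule ballI)
  then obtain K where K: "\<And>e. e \<in> edges G \<Longrightarrow> 0 \<le> K e"
    "\<And>e f. e \<in> edges G \<Longrightarrow> L2_on (elen G e) f \<Longrightarrow> \<exists>p. P e (K e) f p"
    by metis
  define K' where "K' = (\<Sum>e\<in>edges G. K e)"
  have K': "K e \<le> K'" if "e \<in> edges G" for e
    unfolding K'_def using that K(1) finite_edges by (intro member_le_sum) auto
  have K0: "0 \<le> K'" unfolding K'_def using K(1) by (intro sum_nonneg) auto
  define K'' where "K'' = K' * (1 + 1 / sqrt w)"
  have "\<exists>p. solves_on_edges G (k\<^sup>2) f p \<and>
    (\<forall>e\<in>edges G. \<forall>x\<in>{0..elen G e}. cmod (p e x) \<le> K'' * L2_graph_norm w G f \<and>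
       cmod (edge_deriv G p e x) \<le> K'' * L2_graph_norm w G f)" if f: "f \<in> L2_graph G" for f
  proof -
    have le: "K e * L2_norm_on (elen G e) (f e) \<le> K'' * L2_graph_norm w G f" if "e \<in> edges G" for e
    proof -
      have "K e * L2_norm_on (elen G e) (f e) \<le> K' * ((1 + 1 / sqrt w) * L2_graph_norm w G f)"
        using that K0 by (intro mult_mono K' L2_norm_on_le_graph_norm L2_norm_on_nonneg)
      then show ?thesis by (simp add: K''_def)
    qed
    have "\<forall>e\<in>edges G. \<exists>p. P e (K e) (f e) p"
      using K(2) f by (auto simp: L2_graph_def)
    then obtain p where "\<And>e. e \<in> edges G \<Longrightarrow> P e (K e) (f e) (p e)"
      by metis
    then have p: "\<And>e. e \<in> edges G \<Longrightarrow> H2_deriv2 (elen G e) (p e) (\<lambda>x. - (f e x + k\<^sup>2 * p e x))"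
      "\<And>e x. e \<in> edges G \<Longrightarrow> x \<in> {0..elen G e} \<Longrightarrow> cmod (p e x) \<le> K e * L2_norm_on (elen G e) (f e) \<and>
       cmod (vector_derivative (p e) (at x within {0..elen G e})) \<le> K e * L2_norm_on (elen G e) (f e)"
      unfolding P_def by blast+
    define u where "u = (\<lambda>e x. if e \<in> edges G \<and> x \<in> {0..elen G e} then p e x else 0)"
    have u_eq: "u e x = p e x" if "e \<in> edges G" "x \<in> {0..elen G e}" for e x
      using that by (simp add: u_def)
    have "H2_deriv2 (elen G e) (u e) (\<lambda>x. - (f e x + k\<^sup>2 * u e x))" if "e \<in> edges G" for e
      by (rule H2_deriv2_cong[THEN iffD1, OF _ _ p(1)[OF that]]) (use that in \<open>simp_all add: u_eq\<close>)
    then have "solves_on_edges G (k\<^sup>2) f u"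
      by (auto simp: solves_on_edges_def u_def)
    moreover have "edge_deriv G u e x = vector_derivative (p e) (at x within {0..elen G e})"
      if "e \<in> edges G" "x \<in> {0..elen G e}" for e x
    proof (rule edge_deriv_eq[OF that])
      show "(u e has_vector_derivative vector_derivative (p e) (at x within {0..elen G e})) (at x within {0..elen G e})"
        using H2_deriv2_has_derivative[OF elen_pos p(1)] that
        by (subst has_vector_derivative_cong_ev[where g = "p e"]) (auto simp: u_eq eventually_at_filter)
    qed
    ultimately show ?thesis
      using p(2) le by (intro exI[of _ u]) (force simp: u_eq)
  qed
  moreover have "0 \<le> K''" using K0 w by (simp add: K''_def)
  ultimately show ?thesis by blast
qed

text \<open>A crude constant valid for all four kinds of defect: the 2 covers a difference of two
  values, and \<open>n\<close> and \<open>w * n\<close> cover the two sums in the Kirchhoff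
  condition, each with at most \<open>n\<close> terms.\<close>

lemma vertex_defect_bound:
  assumes b: "\<And>e x. e \<in> edges G \<Longrightarrow> x \<in> {0..elen G e} \<Longrightarrow> cmod (u e x) \<le> b \<and> cmod (edge_deriv G u e x) \<le> b"
    and j: "j \<in> edges G \<times> UNIV"
  shows "cmod (vertex_defect w G u j) \<le> (2 + n + w * n) * b"
proof -
  have b0: "0 \<le> b"
    using b[of "Side 0" 0] n l[of 0] by (auto intro: order_trans[OF norm_ge_zero])
  have b': "cmod (u (Side i) 0) \<le> b" "cmod (u (Tooth i) 0) \<le> b" "cmod (u (Side i) (l i)) \<le> b"
     "cmod (edge_deriv G u (Side i) 0) \<le> b" "cmod (edge_deriv G u (Side i) (l i)) \<le> b"
     "cmod (edge_deriv G u (Tooth i) 0) \<le> b" "cmod (edge_deriv G u (Tooth i) (l i)) \<le> b" if "i < n" for i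
    using b[of "Side i"] b[of "Tooth i"] less_imp_le[OF l[OF that]] that by auto
  have nb: "0 \<le> n * b" "0 \<le> w * n * b" using b0 w by auto
  have e: "cmod (x - y) \<le> (2 + n + w * n) * b" if "cmod x \<le> b" "cmod y \<le> b" for x y
    using norm_triangle_ineq4[of x y] that nb by (simp add: algebra_simps)
  have e1: "cmod x \<le> (2 + n + w * n) * b" if "cmod x \<le> b" for x
    using e[of x 0] that b0 by simp
  have sm: "cmod (\<Sum>i | i < n \<and> P i. g i) \<le> n * b" if "\<And>i. i < n \<Longrightarrow> cmod (g i) \<le> b" for P g
  proof -
    have "cmod (\<Sum>i | i < n \<and> P i. g i) \<le> real (card {i. i < n \<and> P i}) * b"
      using that by (intro sum_norm_bound) auto
    also have "\<dots> \<le> n * b"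
      using b0 card_mono[of "{..<n}" "{i. i < n \<and> P i}"] by (intro mult_right_mono) auto
    finally show ?thesis .
  qed
  have kirch: "cmod (vertex_defect w G u (Side v, True)) \<le> (2 + n + w * n) * b" if v: "v < n" for v
  proof -
    have "cmod (vertex_defect w G u (Side v, True)) \<le> b + n * b + w * (n * b)"
      unfolding vertex_defect.simps sides using v w b'
      by (intro norm_triangle_le[OF add_mono] norm_triangle_le sm)
        (auto simp: norm_mult intro!: add_mono sm mult_left_mono)
    then show ?thesis using b0 by (simp add: algebra_simps)
  qed
  have "cmod (vertex_defect w G u (Side i, False)) \<le> (2 + n + w * n) * b"
    "cmod (vertex_defect w G u (Tooth i, False)) \<le> (2 + n + w * n) * b"
    "cmod (vertex_defect w G u (Tooth i, True)) \<le> (2 + n + w * n) * b" if i: "i < n" for i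
    using i e[OF b'(3)[OF i] b'(1)[OF nxt_less]] e[OF b'(2)[OF i] b'(1)[OF att_less[OF i]]] e1[OF b'(7)[OF i]]
    by simp_all
  with kirch have "\<forall>j\<in>edges G \<times> UNIV. cmod (vertex_defect w G u j) \<le> (2 + n + w * n) * b"
    unfolding Ball_edges_bool sides by blast
  with j show ?thesis by blast
qed

lemma wave_bound:
  "\<exists>E\<ge>0. \<forall>c b e x. (\<forall>j\<in>edges G \<times> UNIV. cmod (c j) \<le> b) \<longrightarrow> e \<in> edges G \<longrightarrow> x \<in> {0..elen G e} \<longrightarrow>
     cmod (wave G k c e x) \<le> E * b"
proof -
  define L where "L = (\<Sum>e\<in>edges G. elen G e)"
  have L: "elen G e \<le> L" if "e \<in> edges G" for e
    unfolding L_def using that less_imp_le[OF elen_pos] finite_edges by (intro member_le_sum) auto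
  have cc: "continuous_on {0..L} (\<lambda>x. cos (k * of_real x))" "continuous_on {0..L} (\<lambda>x. sin (k * of_real x))"
    by (intro continuous_intros)+
  obtain M1 M2 where M: "\<And>x. x \<in> {0..L} \<Longrightarrow> cmod (cos (k * of_real x)) \<le> M1" "0 \<le> M1"
      "\<And>x. x \<in> {0..L} \<Longrightarrow> cmod (sin (k * of_real x)) \<le> M2" "0 \<le> M2"
    using continuous_on_compact_bound[OF compact_Icc cc(1)] continuous_on_compact_bound[OF compact_Icc cc(2)] by metis
  have "cmod (wave G k c e x) \<le> (M1 + M2) * b"
    if c: "\<forall>j\<in>edges G \<times> UNIV. cmod (c j) \<le> b" and e: "e \<in> edges G" and x: "x \<in> {0..elen G e}" for c b e x
  proof -
    have x': "x \<in> {0..L}" using x L[OF e] by auto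
    have cb: "cmod (c (e, False)) \<le> b" "cmod (c (e, True)) \<le> b" using c e by auto
    then have b0: "0 \<le> b" using norm_ge_zero order_trans by blast
    have "cmod (wave G k c e x) \<le> cmod (c (e, False) * cos (k * of_real x)) + cmod (c (e, True) * sin (k * of_real x))"
      using e x by (simp add: wave_def norm_triangle_ineq)
    also have "\<dots> \<le> b * M1 + b * M2"
      unfolding norm_mult using cb b0 M x' by (intro add_mono mult_mono) auto
    finally show ?thesis by (simp add: algebra_simps)
  qed
  then show ?thesis using M by (intro exI[of _ "M1 + M2"]) auto
qed

text \<open>A particular solution generally violates the vertex conditions; a wave with the opposite
  defects repairs it, and every step is bounded by a multiple of the norm of
  \<open>f\<close>.\<close>

lemma trivial_eigenspace_imp_solvable:
  assumes k: "k \<noteq> 0" and triv: "\<And>u. u \<in> eigenspace w G (k\<^sup>2) \<Longrightarrow> u = (\<lambda>e x. 0)"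
  shows "\<exists>C. \<forall>f\<in>L2_graph G. \<exists>u. laplacian w G u (\<lambda>e x. f e x + k\<^sup>2 * u e x) \<and>
    L2_graph_norm w G u \<le> C * L2_graph_norm w G f"
proof -
  let ?S = "edges G \<times> (UNIV :: bool set)"
  have fS: "finite ?S" by (simp add: finite_edges)
  obtain R where R: "\<And>r i. i \<in> ?S \<Longrightarrow> vertex_defect w G (wave G k (\<lambda>m. \<Sum>j\<in>?S. r j * R j m)) i = r i"
    using wave_vertex_defects_surj[OF assms] by blast
  obtain K where K: "0 \<le> K" "\<And>f. f \<in> L2_graph G \<Longrightarrow> \<exists>p. solves_on_edges G (k\<^sup>2) f p \<and>
    (\<forall>e\<in>edges G. \<forall>x\<in>{0..elen G e}. cmod (p e x) \<le> K * L2_graph_norm w G f \<and>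
       cmod (edge_deriv G p e x) \<le> K * L2_graph_norm w G f)"
    using particular_solution_graph[OF k] by blast
  obtain E where E: "0 \<le> E" "\<And>c b e x. (\<forall>j\<in>?S. cmod (c j) \<le> b) \<Longrightarrow> e \<in> edges G \<Longrightarrow> x \<in> {0..elen G e} \<Longrightarrow>
     cmod (wave G k c e x) \<le> E * b"
    using wave_bound[of k] by blast
  define D where "D = (2 + n + w * n :: real)"
  have D0: "0 \<le> D" using w by (simp add: D_def)
  define A where "A = (\<Sum>m\<in>?S. \<Sum>j\<in>?S. cmod (R j m))"
  have A0: "0 \<le> A" unfolding A_def by (intro sum_nonneg) auto
  have A: "(\<Sum>j\<in>?S. cmod (R j m)) \<le> A" if "m \<in> ?S" for m
    unfolding A_def using that fS by (intro member_le_sum) (auto intro: sum_nonneg)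
  \<comment> \<open>\<open>K\<close> bounds the particular solution, \<open>D * K\<close> its
    defects, \<open>A\<close> the right inverse that turns defects into wave coefficients, and
    \<open>E\<close> the wave in terms of its coefficients. The square root passes from a uniform
    bound to the graph norm.\<close>
  define C where "C = sqrt (\<Sum>i<n. l i * (1 + w)) * (K + E * (D * K * A))"
  have "\<exists>u. laplacian w G u (\<lambda>e x. f e x + k\<^sup>2 * u e x) \<and> L2_graph_norm w G u \<le> C * L2_graph_norm w G f"
    if f: "f \<in> L2_graph G" for f
  proof -
    define N where "N = L2_graph_norm w G f"
    have N0: "0 \<le> N"
      unfolding N_def L2_graph_norm_def using w by (intro real_sqrt_ge_zero sum_nonneg) auto
    obtain p where p: "solves_on_edges G (k\<^sup>2) f p"
      and pN: "\<And>e x. e \<in> edges G \<Longrightarrow> x \<in> {0..elen G e} \<Longrightarrow>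
         cmod (p e x) \<le> K * N \<and> cmod (edge_deriv G p e x) \<le> K * N"
      using K(2)[OF f] unfolding N_def by blast
    define c where "c = (\<lambda>m. \<Sum>j\<in>?S. (- vertex_defect w G p j) * R j m)"
    define u where "u = (\<lambda>e x. p e x + 1 * wave G k c e x)"
    have c: "cmod (c m) \<le> D * K * A * N" if m: "m \<in> ?S" for m
    proof -
      have "cmod (c m) \<le> (\<Sum>j\<in>?S. D * (K * N) * cmod (R j m))"
        unfolding c_def D_def using vertex_defect_bound[OF pN]
        by (intro sum_norm_le) (auto simp: norm_mult intro!: mult_right_mono)
      also have "\<dots> \<le> D * (K * N) * A"
        unfolding sum_distrib_left[symmetric] using D0 K(1) N0 by (intro mult_left_mono A m) auto
      finally show ?thesis by (simp add: algebra_simps)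
    qed
    have su: "solves_on_edges G (k\<^sup>2) f u"
      using solves_on_edges_linear[OF p solves_on_edges_wave[of k c], of 1] by (simp add: u_def)
    have "vertex_defect w G u j = 0" if "j \<in> ?S" for j
      unfolding u_def vertex_defect_linear[OF p solves_on_edges_wave that] c_def using R[OF that, of "\<lambda>j. - vertex_defect w G p j"]
      by (simp only: mult_1 add.right_inverse)
    with su have lu: "laplacian w G u (\<lambda>e x. f e x + k\<^sup>2 * u e x)"
      unfolding laplacian_iff by blast
    have ub: "cmod (u e x) \<le> (K + E * (D * K * A)) * N" if e: "e \<in> edges G" and x: "x \<in> {0..elen G e}" for e x
    proof -
      have "cmod (u e x) \<le> cmod (p e x) + cmod (wave G k c e x)"
        by (simp add: u_def norm_triangle_ineq)
      also have "\<dots> \<le> K * N + E * (D * K * A * N)"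
        using pN[OF e x] E(2)[of c, OF _ e x] c by (intro add_mono) auto
      finally show ?thesis by (simp add: algebra_simps)
    qed
    have "L2_on (elen G e) (u e)" if "e \<in> edges G" for e
      using has_edge_deriv[OF su that]
      by (intro L2_on_continuous has_vector_derivative_imp_continuous_on)
    then have "L2_graph_norm w G u \<le> sqrt (\<Sum>i<n. l i * (1 + w)) * ((K + E * (D * K * A)) * N)"
      using K(1) E(1) D0 A0 N0 ub by (intro L2_graph_norm_le) auto
    with lu show ?thesis by (auto simp: C_def N_def algebra_simps)
  qed
  then show ?thesis by blast
qed

lemma resolvent_set_iff:
  assumes k: "k \<noteq> 0"
  shows "k\<^sup>2 \<in> resolvent_set w G \<longleftrightarrow> eigenspace w G (k\<^sup>2) = {\<lambda>e x. 0}"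
proof
  assume "k\<^sup>2 \<in> resolvent_set w G"
  then show "eigenspace w G (k\<^sup>2) = {\<lambda>e x. 0}"
    using resolvent_imp_trivial_eigenspace zero_in_eigenspace by blast
next
  assume e: "eigenspace w G (k\<^sup>2) = {\<lambda>e x. 0}"
  have uniq: "u = v" if "laplacian w G u (\<lambda>e x. f e x + k\<^sup>2 * u e x)"
      "laplacian w G v (\<lambda>e x. f e x + k\<^sup>2 * v e x)" for f u v
    using diff_in_eigenspace[OF that] e by (auto simp: fun_eq_iff)
  obtain C where C: "\<And>f. f \<in> L2_graph G \<Longrightarrow> \<exists>u. laplacian w G u (\<lambda>e x. f e x + k\<^sup>2 * u e x) \<and>
      L2_graph_norm w G u \<le> C * L2_graph_norm w G f"
    using trivial_eigenspace_imp_solvable[OF k] e by blast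
  have "\<exists>!u. laplacian w G u (\<lambda>e x. f e x + k\<^sup>2 * u e x)" if "f \<in> L2_graph G" for f
    by (rule ex_ex1I) (use C[OF that] uniq in \<open>blast+\<close>)
  \<comment> \<open>The estimate is known for one constructed solution; uniqueness carries it over
    to every solution, as \<open>resolvent_set\<close> demands.\<close>
  moreover have "L2_graph_norm w G u \<le> C * L2_graph_norm w G f"
    if f: "f \<in> L2_graph G" and u: "laplacian w G u (\<lambda>e x. f e x + k\<^sup>2 * u e x)" for f u
    using C[OF f] uniq[OF u] by metis
  ultimately show "k\<^sup>2 \<in> resolvent_set w G"
    unfolding resolvent_set_def mem_Collect_eq by blast
qed

end

section \<open>Duality\<close>

text \<open>The map \<open>f\<close> is linear only on \<open>E\<close>, since differentiation is
  not linear on all of \<open>edge_fun\<close>. It is replaced by a globally linear \<open>g\<close>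
  that extends its values on a basis of \<open>E\<close> and agrees with it on all of
  \<open>E\<close>.\<close>

lemma edge_fun_dim_eq_of_bij:
  assumes E: "edge_fun.subspace E"
    and lin: "\<And>a u v. u \<in> E \<Longrightarrow> v \<in> E \<Longrightarrow> f (\<lambda>e x. u e x + a * v e x) = (\<lambda>e x. f u e x + a * f v e x)"
    and bij: "bij_betw f E E'"
  shows "edge_fun.dim E = edge_fun.dim E'"
proof -
  interpret P: vector_space_pair scale_fun scale_fun ..
  have lin': "f (u + scale_fun a v) = f u + scale_fun a (f v)" if "u \<in> E" "v \<in> E" for a u v
    using lin[OF that, of a] by (simp add: scale_fun_def plus_fun_def)
  obtain B where B: "B \<subseteq> E" "edge_fun.independent B" "E \<subseteq> edge_fun.span B"
      "card B = edge_fun.dim E"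
    by (rule edge_fun.basis_exists)
  obtain g where g: "Vector_Spaces.linear scale_fun scale_fun g" "\<forall>x\<in>B. g x = f x"
    using P.linear_independent_extend[OF B(2)] by blast
  interpret g: Vector_Spaces.linear scale_fun scale_fun g by (rule g(1))
  have f0: "f 0 = 0"
    using lin'[of 0 0 "- 1"] edge_fun.subspace_0[OF E] by (simp add: edge_fun.scale_minus_left)
  have "edge_fun.subspace {u \<in> E. g u = f u}"
  proof (rule edge_fun.subspaceI)
    show "0 \<in> {u \<in> E. g u = f u}"
      using edge_fun.subspace_0[OF E] by (simp add: f0 g.zero)
    show "u + v \<in> {u \<in> E. g u = f u}" if "u \<in> {u \<in> E. g u = f u}" "v \<in> {u \<in> E. g u = f u}" for u v
      using that lin'[of u v 1] edge_fun.subspace_add[OF E] by (simp add: g.add)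
    show "scale_fun a u \<in> {u \<in> E. g u = f u}" if "u \<in> {u \<in> E. g u = f u}" for a u
      using that lin'[of 0 u a] edge_fun.subspace_0[OF E] edge_fun.subspace_scale[OF E]
      by (simp add: g.scale f0)
  qed
  then have "edge_fun.span B \<subseteq> {u \<in> E. g u = f u}"
    using B(1) g(2) by (intro edge_fun.span_minimal) auto
  then have gf: "g u = f u" if "u \<in> E" for u
    using that B(3) by blast
  have span: "edge_fun.span B = E"
    using B(1,3) E edge_fun.span_minimal by blast
  have inj: "inj_on g (edge_fun.span B)"
    unfolding span using bij gf by (auto simp: bij_betw_def inj_on_def)
  have im: "g ` E = E'"
    using bij gf by (auto simp: bij_betw_def)
  have "edge_fun.dim E' = card B"
  proof (rule edge_fun.dim_unique)
    show "g ` B \<subseteq> E'" using im B(1) by blast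
    show "E' \<subseteq> edge_fun.span (g ` B)"
      using im by (simp add: P.linear_span_image[OF g(1)] span)
    show "edge_fun.independent (g ` B)"
      by (rule P.linear_independent_injective_image[OF g(1) B(2) inj])
    show "card (g ` B) = card B"
      by (intro card_image inj_on_subset[OF inj] edge_fun.span_superset)
  qed
  with B(4) show ?thesis by simp
qed

section \<open>Vertex conditions indexed by sides\<close>

context weighted_gear
begin

lemma nxt_inj: "i < n \<Longrightarrow> j < n \<Longrightarrow> nxt G i = nxt G j \<Longrightarrow> i = j"
  using n by (auto simp: nxt_def mod_Suc split: if_splits)

lemma nxt_neq: "i < n \<Longrightarrow> nxt G i \<noteq> i"
  using n by (auto simp: nxt_def mod_Suc)

lemma nxt_surj: "v < n \<Longrightarrow> \<exists>i<n. v = nxt G i"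
  using n by (intro exI[of _ "if v = 0 then n - 1 else v - 1"]) (auto simp: nxt_def)

text \<open>At the vertex \<open>nxt G i\<close> exactly one side ends and one begins, and only the
  teeth of these two sides can be attached there. The two are distinct by \<open>nxt_neq\<close>, so
  the sums collapse to case distinctions.\<close>

lemma kirchhoff_defect:
  assumes i: "i < n"
  shows "vertex_defect w G u (Side (nxt G i), True) =
    edge_deriv G u (Side (nxt G i)) 0 - edge_deriv G u (Side i) (l i)
    + of_real w * ((if att G (nxt G i) = nxt G i then edge_deriv G u (Tooth (nxt G i)) 0 else 0)
       + (if att G i = i then 0 else edge_deriv G u (Tooth i) 0))"
proof -
  have s: "{j. j < n \<and> nxt G j = nxt G i} = {i}"
    using i nxt_inj by auto
  have t: "{j. j < n \<and> att G j = nxt G i} =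
      (if att G (nxt G i) = nxt G i then {nxt G i} else {}) \<union> (if att G i = i then {} else {i})"
  proof -
    have "j < n \<and> att G j = nxt G i \<longleftrightarrow> j = nxt G i \<and> att G (nxt G i) = nxt G i \<or> j = i \<and> att G i \<noteq> i" for j
    proof
      assume j: "j < n \<and> att G j = nxt G i"
      then consider "att G j = j" | "att G j = nxt G j" using att by blast
      then show "j = nxt G i \<and> att G (nxt G i) = nxt G i \<or> j = i \<and> att G i \<noteq> i"
      proof cases
        case 1
        with j have "j = nxt G i" by simp
        with 1 show ?thesis by blast
      next
        case 2
        with j have "j = i" by (intro nxt_inj[OF _ i]) auto
        with j nxt_neq[OF i] show ?thesis by metis
      qed
    next
      assume "j = nxt G i \<and> att G (nxt G i) = nxt G i \<or> j = i \<and> att G i \<noteq> i"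
      then show "j < n \<and> att G j = nxt G i"
        using att[OF i] i by auto
    qed
    then show ?thesis by auto
  qed
  have "(\<Sum>j | j < n \<and> att G j = nxt G i. edge_deriv G u (Tooth j) 0) =
      (if att G (nxt G i) = nxt G i then edge_deriv G u (Tooth (nxt G i)) 0 else 0)
      + (if att G i = i then 0 else edge_deriv G u (Tooth i) 0)"
    unfolding t using nxt_neq[OF i] by (subst sum.union_disjoint) auto
  then show ?thesis
    using i by (simp add: s)
qed

lemma all_nxt: "(\<forall>v<n. P v) \<longleftrightarrow> (\<forall>i<n. P (nxt G i))"
  using nxt_surj nxt_less by blast

text \<open>
  For an eigenfunction \<open>u\<close> with derivative \<open>d\<close>; the Kirchhoff condition at the vertex \<open>nxt G i\<close> is
  indexed by the side \<open>i\<close> that ends there.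
\<close>

definition eigen_pair :: "complex \<Rightarrow> edge_fun \<Rightarrow> edge_fun \<Rightarrow> bool" where
  "eigen_pair \<mu> u d \<longleftrightarrow>
     (\<forall>e\<in>edges G. \<forall>x\<in>{0..elen G e}. (u e has_vector_derivative d e x) (at x within {0..elen G e})
        \<and> (d e has_vector_derivative - (\<mu> * u e x)) (at x within {0..elen G e}))
     \<and> (\<forall>i<n. u (Side (nxt G i)) 0 = u (Side i) (l i)
        \<and> u (Tooth i) 0 = (if att G i = i then u (Side i) 0 else u (Side i) (l i))
        \<and> d (Side (nxt G i)) 0 + of_real w * (if att G (nxt G i) = nxt G i then d (Tooth (nxt G i)) 0 else 0)
           = d (Side i) (l i) - of_real w * (if att G i = i then 0 else d (Tooth i) 0)
        \<and> d (Tooth i) (l i) = 0)"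

text \<open>The Kirchhoff condition is arranged as an equation of fluxes: the left-hand side belongs
  to side and tooth \<open>nxt G i\<close>, the right-hand side to side and tooth \<open>i\<close>.
  In this form it is literally a continuity condition for \<open>dual_map\<close>.\<close>

lemma vertex_defects_eq_0_iff:
  "(\<forall>j\<in>edges G \<times> UNIV. vertex_defect w G u j = 0) \<longleftrightarrow>
    (\<forall>i<n. u (Side (nxt G i)) 0 = u (Side i) (l i)
        \<and> u (Tooth i) 0 = (if att G i = i then u (Side i) 0 else u (Side i) (l i))
        \<and> edge_deriv G u (Side (nxt G i)) 0
            + of_real w * (if att G (nxt G i) = nxt G i then edge_deriv G u (Tooth (nxt G i)) 0 else 0)
           = edge_deriv G u (Side i) (l i) - of_real w * (if att G i = i then 0 else edge_deriv G u (Tooth i) 0)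
        \<and> edge_deriv G u (Tooth i) (l i) = 0)" (is "_ \<longleftrightarrow> ?R")
proof -
  have k: "vertex_defect w G u (Side (nxt G i), True) = 0 \<longleftrightarrow> edge_deriv G u (Side (nxt G i)) 0
            + of_real w * (if att G (nxt G i) = nxt G i then edge_deriv G u (Tooth (nxt G i)) 0 else 0)
           = edge_deriv G u (Side i) (l i) - of_real w * (if att G i = i then 0 else edge_deriv G u (Tooth i) 0)"
    if "i < n" for i
    unfolding kirchhoff_defect[OF that] by (auto simp: algebra_simps add_eq_0_iff)
  have t: "u (Side i) (l i) = u (Side (nxt G i)) 0 \<Longrightarrow> u (Tooth i) 0 = u (Side (att G i)) 0 \<longleftrightarrow>
      u (Tooth i) 0 = (if att G i = i then u (Side i) 0 else u (Side i) (l i))" if "i < n" for i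
    using att[OF that] by auto
  have "(\<forall>j\<in>edges G \<times> UNIV. vertex_defect w G u j = 0) \<longleftrightarrow>
      (\<forall>i<n. vertex_defect w G u (Side i, False) = 0 \<and> vertex_defect w G u (Tooth i, False) = 0
        \<and> vertex_defect w G u (Tooth i, True) = 0) \<and> (\<forall>v<n. vertex_defect w G u (Side v, True) = 0)"
    unfolding Ball_edges_bool sides by blast
  also have "\<dots> \<longleftrightarrow> (\<forall>i<n. u (Side i) (l i) = u (Side (nxt G i)) 0 \<and> u (Tooth i) 0 = u (Side (att G i)) 0
      \<and> edge_deriv G u (Tooth i) (l i) = 0) \<and> (\<forall>i<n. vertex_defect w G u (Side (nxt G i), True) = 0)"
    unfolding all_nxt[of "\<lambda>v. vertex_defect w G u (Side v, True) = 0"] by (simp del: vertex_defect.simps(3))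
  also have "\<dots> \<longleftrightarrow> ?R"
    using k t by metis
  finally show ?thesis .
qed

text \<open>The second conclusion identifies the candidate \<open>d\<close> with the actual
  derivative, which is needed to apply the transplantation a second time.\<close>

lemma eigenspaceI:
  assumes "\<And>e x. e \<notin> edges G \<or> x \<notin> {0..elen G e} \<Longrightarrow> u e x = 0" and p: "eigen_pair \<mu> u d"
  shows "u \<in> eigenspace w G \<mu>" and "\<And>e x. e \<in> edges G \<Longrightarrow> x \<in> {0..elen G e} \<Longrightarrow> edge_deriv G u e x = d e x"
proof -
  have ud: "(u e has_vector_derivative d e x) (at x within {0..elen G e})"
      "(d e has_vector_derivative - (\<mu> * u e x)) (at x within {0..elen G e})"
    if "e \<in> edges G" "x \<in> {0..elen G e}" for e x
    using p that unfolding eigen_pair_def by blast+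
  show d: "edge_deriv G u e x = d e x" if "e \<in> edges G" "x \<in> {0..elen G e}" for e x
    using that ud by (intro edge_deriv_eq)
  have "H2_deriv2 (elen G e) (u e) (\<lambda>x. - (0 + \<mu> * u e x))" if "e \<in> edges G" for e
    unfolding add_0
    by (intro H2_deriv2_classical[OF ud[OF that]] continuous_intros
        has_vector_derivative_imp_continuous_on[OF ud(1)[OF that]])
  moreover have d': "edge_deriv G u (Side i) 0 = d (Side i) 0" "edge_deriv G u (Tooth i) 0 = d (Tooth i) 0"
      "edge_deriv G u (Side i) (l i) = d (Side i) (l i)" "edge_deriv G u (Tooth i) (l i) = d (Tooth i) (l i)"
    if "i < n" for i
    using that less_imp_le[OF l[OF that]] by (auto intro!: d)
  ultimately show "u \<in> eigenspace w G \<mu>"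
    using assms unfolding eigenspace_iff solves_on_edges_def vertex_defects_eq_0_iff eigen_pair_def
    by (auto simp del: if_split_asm)
qed

lemma eigenspaceD:
  assumes "u \<in> eigenspace w G \<mu>"
  shows "\<And>e x. e \<notin> edges G \<or> x \<notin> {0..elen G e} \<Longrightarrow> u e x = 0"
    and "eigen_pair \<mu> u (edge_deriv G u)"
proof -
  have s: "solves_on_edges G \<mu> (\<lambda>e x. 0) u" and v: "\<forall>j\<in>edges G \<times> UNIV. vertex_defect w G u j = 0"
    using assms by (auto simp: eigenspace_iff)
  show "u e x = 0" if "e \<notin> edges G \<or> x \<notin> {0..elen G e}" for e x
    using s that by (auto simp: solves_on_edges_def)
  have "(edge_deriv G u e has_vector_derivative - \<mu> * u e x) (at x within {0..elen G e})"
    if "e \<in> edges G" "x \<in> {0..elen G e}" for e x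
    unfolding edge_deriv_def using that s
    by (intro H2_deriv2_eigen elen_pos) (auto simp: solves_on_edges_def)
  with v has_edge_deriv[OF s] show "eigen_pair \<mu> u (edge_deriv G u)"
    unfolding eigen_pair_def vertex_defects_eq_0_iff by simp
qed

lemma subspace_eigenspace: "edge_fun.subspace (eigenspace w G \<mu>)"
proof (rule edge_fun.subspaceI)
  show z: "0 \<in> eigenspace w G \<mu>"
    using zero_in_eigenspace by (simp add: zero_fun_def)
  show "u + v \<in> eigenspace w G \<mu>" if "u \<in> eigenspace w G \<mu>" "v \<in> eigenspace w G \<mu>" for u v
    using eigenspace_linear[OF that, of 1] by (simp add: plus_fun_def)
  show "scale_fun a u \<in> eigenspace w G \<mu>" if "u \<in> eigenspace w G \<mu>" for a u
    using eigenspace_linear[OF z that, of a] by (simp add: scale_fun_def)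
qed

end

text \<open>
  The argument \<open>d\<close> is the derivative of an eigenfunction. Read in the direction of its side, a tooth
  function \<open>h\<close> and the side function \<open>f\<close> are mapped to \<open>f' - h'\<close> and \<open>f' + w h'\<close>; here \<open>Tooth i\<close>
  runs against \<open>Side i\<close> exactly if it is attached at the vertex \<open>i + 1\<close>, and the dual tooth runs in
  the opposite direction.
\<close>

fun dual_map :: "real \<Rightarrow> gear \<Rightarrow> edge_fun \<Rightarrow> edge_fun" where
  "dual_map w G d (Side i) x =
     (if i < sides G \<and> x \<in> {0..len G i} then
        if att G i = i then d (Side i) x + of_real w * d (Tooth i) x
        else d (Side i) x - of_real w * d (Tooth i) (len G i - x)
      else 0)"
| "dual_map w G d (Tooth i) x =
     (if i < sides G \<and> x \<in> {0..len G i} then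
        if att G i = i then d (Side i) (len G i - x) - d (Tooth i) (len G i - x)
        else d (Side i) x + d (Tooth i) (len G i - x)
      else 0)"

text \<open>For \<open>- u'' = \<mu> u\<close> this is the derivative of \<open>dual_map w G u'\<close> divided by \<open>- \<mu>\<close>.\<close>

fun dual_map_deriv :: "real \<Rightarrow> gear \<Rightarrow> edge_fun \<Rightarrow> edge_fun" where
  "dual_map_deriv w G u (Side i) x =
     (if att G i = i then u (Side i) x + of_real w * u (Tooth i) x
      else u (Side i) x + of_real w * u (Tooth i) (len G i - x))"
| "dual_map_deriv w G u (Tooth i) x =
     (if att G i = i then u (Tooth i) (len G i - x) - u (Side i) (len G i - x)
      else u (Side i) x - u (Tooth i) (len G i - x))"

text \<open>The relation \<open>att H i \<noteq> att G i\<close> for \<open>i < n\<close> is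
  symmetric, so each result also holds with \<open>G\<close> and \<open>H\<close> exchanged.
  Equality with \<open>dual_gear G\<close> would not be: applying \<open>dual_gear\<close> twice can
  change \<open>att\<close> at indices beyond \<open>n\<close>.\<close>

locale dual_gears = weighted_gear n l G w + H: weighted_gear n l H w
  for n l G w H +
  assumes dual: "i < n \<Longrightarrow> att H i \<noteq> att G i"
begin

lemma nxt_eq: "nxt H i = nxt G i"
  by (simp add: nxt_def)

lemma edges_eq: "edges H = edges G"
  by (simp add: edges_def)

lemma elen_eq: "e \<in> edges G \<Longrightarrow> elen H e = elen G e"
  by (cases e) auto

lemma att_dual: "i < n \<Longrightarrow> att H i = i \<longleftrightarrow> att G i \<noteq> i"
  using dual[of i] att[of i] H.att[of i] nxt_neq[of i] by (auto simp: nxt_eq)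

lemma dual_gears_sym: "dual_gears n l H w G"
  using dual by unfold_locales metis

lemma dual_map_eigen_pair:
  assumes p: "eigen_pair \<mu> u d"
  shows "H.eigen_pair \<mu> (dual_map w G d) (\<lambda>e x. - \<mu> * dual_map_deriv w G u e x)"
proof -
  have pe: "(u e has_vector_derivative d e x) (at x within {0..elen G e})
      \<and> (d e has_vector_derivative - (\<mu> * u e x)) (at x within {0..elen G e})"
    if "e \<in> edges G" "x \<in> {0..elen G e}" for e x
    using p that unfolding eigen_pair_def by blast
  have S: "(u (Side i) has_vector_derivative d (Side i) x) (at x within {0..l i})"
      "(d (Side i) has_vector_derivative - (\<mu> * u (Side i) x)) (at x within {0..l i})"
      "(u (Tooth i) has_vector_derivative d (Tooth i) x) (at x within {0..l i})"
      "(d (Tooth i) has_vector_derivative - (\<mu> * u (Tooth i) x)) (at x within {0..l i})"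
    if "i < n" "x \<in> {0..l i}" for i x
    using pe[of "Side i" x] pe[of "Tooth i" x] that by simp_all
  have R: "((\<lambda>x. u (Side i) (l i - x)) has_vector_derivative - d (Side i) (l i - x)) (at x within {0..l i})"
      "((\<lambda>x. d (Side i) (l i - x)) has_vector_derivative - (- (\<mu> * u (Side i) (l i - x)))) (at x within {0..l i})"
      "((\<lambda>x. u (Tooth i) (l i - x)) has_vector_derivative - d (Tooth i) (l i - x)) (at x within {0..l i})"
      "((\<lambda>x. d (Tooth i) (l i - x)) has_vector_derivative - (- (\<mu> * u (Tooth i) (l i - x)))) (at x within {0..l i})"
    if "i < n" "x \<in> {0..l i}" for i x
    by (rule has_vector_derivative_reflect[OF S(1)[OF that(1)] that(2)]
        has_vector_derivative_reflect[OF S(2)[OF that(1)] that(2)]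
        has_vector_derivative_reflect[OF S(3)[OF that(1)] that(2)]
        has_vector_derivative_reflect[OF S(4)[OF that(1)] that(2)]; assumption)+
  \<comment> \<open>The formulas of \<open>dual_map\<close> without the cut-off, which can be
    differentiated directly; the two agree on the edges.\<close>
  define g where "g = (\<lambda>e x. case e of
      Side i \<Rightarrow> if att G i = i then d (Side i) x + of_real w * d (Tooth i) x
        else d (Side i) x - of_real w * d (Tooth i) (l i - x)
    | Tooth i \<Rightarrow> if att G i = i then d (Side i) (l i - x) - d (Tooth i) (l i - x)
        else d (Side i) x + d (Tooth i) (l i - x))"
  have gd: "dual_map w G d e x = g e x" if "e \<in> edges G" "x \<in> {0..elen G e}" for e x
    using that by (cases e) (auto simp: g_def)
  have d1: "(g e has_vector_derivative - \<mu> * dual_map_deriv w G u e x) (at x within {0..elen G e})"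
    if e: "e \<in> edges G" and x: "x \<in> {0..elen G e}" for e x
  proof (cases e)
    case (Side i)
    with e x have i: "i < n" "x \<in> {0..l i}" by auto
    show ?thesis
    proof (cases "att G i = i")
      case True
      have "((\<lambda>x. d (Side i) x + of_real w * d (Tooth i) x) has_vector_derivative
          - (\<mu> * u (Side i) x) + of_real w * - (\<mu> * u (Tooth i) x)) (at x within {0..l i})"
        by (intro has_vector_derivative_add has_vector_derivative_mult_right S i)
      then show ?thesis using True i Side by (simp add: g_def algebra_simps)
    next
      case False
      have "((\<lambda>x. d (Side i) x - of_real w * d (Tooth i) (l i - x)) has_vector_derivative
          - (\<mu> * u (Side i) x) - of_real w * - (- (\<mu> * u (Tooth i) (l i - x)))) (at x within {0..l i})"
        by (intro has_vector_derivative_diff has_vector_derivative_mult_right S R i)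
      then show ?thesis using False i Side by (simp add: g_def algebra_simps)
    qed
  next
    case (Tooth i)
    with e x have i: "i < n" "x \<in> {0..l i}" by auto
    show ?thesis
    proof (cases "att G i = i")
      case True
      have "((\<lambda>x. d (Side i) (l i - x) - d (Tooth i) (l i - x)) has_vector_derivative
          - (- (\<mu> * u (Side i) (l i - x))) - - (- (\<mu> * u (Tooth i) (l i - x)))) (at x within {0..l i})"
        by (intro has_vector_derivative_diff R i)
      then show ?thesis using True i Tooth by (simp add: g_def algebra_simps)
    next
      case False
      have "((\<lambda>x. d (Side i) x + d (Tooth i) (l i - x)) has_vector_derivative
          - (\<mu> * u (Side i) x) + - (- (\<mu> * u (Tooth i) (l i - x)))) (at x within {0..l i})"
        by (intro has_vector_derivative_add S R i)
      then show ?thesis using False i Tooth by (simp add: g_def algebra_simps)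
    qed
  qed
  have d1': "(dual_map w G d e has_vector_derivative - \<mu> * dual_map_deriv w G u e x) (at x within {0..elen G e})"
    if e: "e \<in> edges G" and x: "x \<in> {0..elen G e}" for e x
    using d1[OF that] x gd[OF e]
    by (subst has_vector_derivative_cong_ev[where g = "g e"]) (auto simp: eventually_at_filter)
  have deriv_eq: "dual_map_deriv w G u (Side i) = (\<lambda>x. if att G i = i then u (Side i) x + of_real w * u (Tooth i) x
      else u (Side i) x + of_real w * u (Tooth i) (l i - x))"
    "dual_map_deriv w G u (Tooth i) = (\<lambda>x. if att G i = i then u (Tooth i) (l i - x) - u (Side i) (l i - x)
      else u (Side i) x - u (Tooth i) (l i - x))" if "i < n" for i
    using that by (auto simp: fun_eq_iff)
  have d2: "((\<lambda>x. - \<mu> * dual_map_deriv w G u e x) has_vector_derivative - (\<mu> * dual_map w G d e x)) (at x within {0..elen G e})"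
    if e: "e \<in> edges G" and x: "x \<in> {0..elen G e}" for e x
  proof -
    have "(dual_map_deriv w G u e has_vector_derivative g e x) (at x within {0..elen G e})"
    proof (cases e)
      case (Side i)
      with e x have i: "i < n" "x \<in> {0..l i}" by auto
      show ?thesis
      proof (cases "att G i = i")
        case True
        have "((\<lambda>x. u (Side i) x + of_real w * u (Tooth i) x) has_vector_derivative
            d (Side i) x + of_real w * d (Tooth i) x) (at x within {0..l i})"
          by (intro has_vector_derivative_add has_vector_derivative_mult_right S i)
        then show ?thesis using True i Side by (simp add: g_def deriv_eq)
      next
        case False
        have "((\<lambda>x. u (Side i) x + of_real w * u (Tooth i) (l i - x)) has_vector_derivative
            d (Side i) x + of_real w * - d (Tooth i) (l i - x)) (at x within {0..l i})"
          by (intro has_vector_derivative_add has_vector_derivative_mult_right S R i)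
        then show ?thesis using False i Side by (simp add: g_def deriv_eq)
      qed
    next
      case (Tooth i)
      with e x have i: "i < n" "x \<in> {0..l i}" by auto
      show ?thesis
      proof (cases "att G i = i")
        case True
        have "((\<lambda>x. u (Tooth i) (l i - x) - u (Side i) (l i - x)) has_vector_derivative
            - d (Tooth i) (l i - x) - - d (Side i) (l i - x)) (at x within {0..l i})"
          by (intro has_vector_derivative_diff R i)
        then show ?thesis using True i Tooth by (simp add: g_def deriv_eq)
      next
        case False
        have "((\<lambda>x. u (Side i) x - u (Tooth i) (l i - x)) has_vector_derivative
            d (Side i) x - - d (Tooth i) (l i - x)) (at x within {0..l i})"
          by (intro has_vector_derivative_diff S R i)
        then show ?thesis using False i Tooth by (simp add: g_def deriv_eq)
      qed
    qed
    from has_vector_derivative_mult_right[OF this, of "- \<mu>"] gd[OF that] show ?thesis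
      by simp
  qed
  have V: "u (Side (nxt G i)) 0 = u (Side i) (l i)"
      "u (Tooth i) 0 = (if att G i = i then u (Side i) 0 else u (Side i) (l i))"
      "d (Side (nxt G i)) 0 + of_real w * (if att G (nxt G i) = nxt G i then d (Tooth (nxt G i)) 0 else 0)
           = d (Side i) (l i) - of_real w * (if att G i = i then 0 else d (Tooth i) 0)"
      "d (Tooth i) (l i) = 0" if "i < n" for i
    using p that unfolding eigen_pair_def by blast+
  define D where "D = dual_map w G d"
  define D' where "D' = dual_map_deriv w G u"
  \<comment> \<open>The boundary values of the new pair. The old Neumann condition removes tooth
    terms from \<open>s0\<close>, \<open>s1\<close> and \<open>t0\<close>; the old continuity of the
    tooth enters \<open>s0'\<close>, \<open>s1'\<close> and \<open>t1'\<close>, and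
    \<open>t1'\<close> is already the new Neumann condition.\<close>
  have s0: "D (Side i) 0 = d (Side i) 0 + of_real w * (if att G i = i then d (Tooth i) 0 else 0)"
    and s1: "D (Side i) (l i) = d (Side i) (l i) - of_real w * (if att G i = i then 0 else d (Tooth i) 0)"
    and t0: "D (Tooth i) 0 = (if att G i = i then d (Side i) (l i) else d (Side i) 0)"
    and s0': "D' (Side i) 0 = u (Side i) 0 + of_real w * (if att G i = i then u (Side i) 0 else u (Tooth i) (l i))"
    and s1': "D' (Side i) (l i) = u (Side i) (l i) + of_real w * (if att G i = i then u (Tooth i) (l i) else u (Side i) (l i))"
    and t0': "D' (Tooth i) 0 = (if att G i = i then u (Tooth i) (l i) - u (Side i) (l i) else u (Side i) 0 - u (Tooth i) (l i))"
    and t1': "D' (Tooth i) (l i) = 0" if i: "i < n" for i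
    using V[OF i] i less_imp_le[OF l[OF i]] by (auto simp: D_def D'_def)
  \<comment> \<open>The first equation is the old Kirchhoff condition. In the third, whichever way
    the teeth are attached, both sides equal \<open>1 + w\<close> times the value of
    \<open>u\<close> at the vertex \<open>nxt G i\<close>.\<close>
  have "D (Side (nxt G i)) 0 = D (Side i) (l i)"
       "D (Tooth i) 0 = (if att H i = i then D (Side i) 0 else D (Side i) (l i))"
       "D' (Side (nxt G i)) 0 + of_real w * (if att H (nxt G i) = nxt G i then D' (Tooth (nxt G i)) 0 else 0)
           = D' (Side i) (l i) - of_real w * (if att H i = i then 0 else D' (Tooth i) 0)"
       "D' (Tooth i) (l i) = 0" if i: "i < n" for i
    using V[OF i] i
    by (simp_all add: s0 s1 t0 s0' s1' t0' t1' att_dual algebra_simps)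
  moreover from this(3) have "- \<mu> * D' (Side (nxt G i)) 0
         + of_real w * (if att H (nxt G i) = nxt G i then - \<mu> * D' (Tooth (nxt G i)) 0 else 0)
       = - \<mu> * D' (Side i) (l i) - of_real w * (if att H i = i then 0 else - \<mu> * D' (Tooth i) 0)" if i: "i < n" for i
    using arg_cong[of _ _ "\<lambda>z. - \<mu> * z", OF that[THEN calculation(3)]]
    by (auto simp: algebra_simps split: if_splits)
  ultimately show ?thesis
    using d1' d2 unfolding H.eigen_pair_def edges_eq nxt_eq D_def D'_def
    by (auto simp: elen_eq simp del: dual_map.simps dual_map_deriv.simps)
qed

lemma dual_map_eigenspace:
  assumes u: "u \<in> eigenspace w G \<mu>"
  shows "dual_map w G (edge_deriv G u) \<in> eigenspace w H \<mu>"
    and "e \<in> edges G \<Longrightarrow> x \<in> {0..elen G e} \<Longrightarrow>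
      edge_deriv H (dual_map w G (edge_deriv G u)) e x = - \<mu> * dual_map_deriv w G u e x"
proof -
  have z: "dual_map w G (edge_deriv G u) e x = 0" if "e \<notin> edges H \<or> x \<notin> {0..elen H e}" for e x
    using that by (cases e) (auto simp: edges_eq)
  note * = H.eigenspaceI[OF z dual_map_eigen_pair[OF eigenspaceD(2)[OF u]]]
  show "dual_map w G (edge_deriv G u) \<in> eigenspace w H \<mu>"
    by (rule *(1))
  show "e \<in> edges G \<Longrightarrow> x \<in> {0..elen G e} \<Longrightarrow>
      edge_deriv H (dual_map w G (edge_deriv G u)) e x = - \<mu> * dual_map_deriv w G u e x"
    using *(2)[of e x] by (simp add: edges_eq elen_eq)
qed

text \<open>On the pair (side, tooth) the map is differentiation followed by the matrix with rows
  (1, w) and (1, -1), whose square is 1 + w times the identity; the two differentiations contribute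
  the factor \<open>- \<mu>\<close>.\<close>

lemma dual_map_dual_map:
  assumes u: "u \<in> eigenspace w G \<mu>"
  shows "dual_map w H (edge_deriv H (dual_map w G (edge_deriv G u)))
    = (\<lambda>e x. - (1 + of_real w) * \<mu> * u e x)"
proof (intro ext)
  fix e x
  note D = dual_map_eigenspace(2)[OF u]
  show "dual_map w H (edge_deriv H (dual_map w G (edge_deriv G u))) e x = - (1 + of_real w) * \<mu> * u e x"
  proof (cases "e \<in> edges G \<and> x \<in> {0..elen G e}")
    case False
    then show ?thesis
      using eigenspaceD(1)[OF u, of e x] by (cases e) auto
  next
    case True
    then obtain i where i: "i < n" "x \<in> {0..l i}" "e = Side i \<or> e = Tooth i"
      by (cases e) auto
    have "edge_deriv H (dual_map w G (edge_deriv G u)) (Side i) y = - \<mu> * dual_map_deriv w G u (Side i) y"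
      "edge_deriv H (dual_map w G (edge_deriv G u)) (Tooth i) y = - \<mu> * dual_map_deriv w G u (Tooth i) y"
      if "y \<in> {0..l i}" for y
      using D[of "Side i" y] D[of "Tooth i" y] that i by (simp_all del: dual_map_deriv.simps)
    note E = this[OF i(2)] this[of "l i - x"]
    show ?thesis
      using i att_dual[OF i(1)]
      by (elim disjE; cases "att G i = i") (simp_all add: E, simp_all add: algebra_simps)
  qed
qed

lemma dual_map_linear:
  assumes "u \<in> eigenspace w G \<mu>" "v \<in> eigenspace w G \<mu>"
  shows "dual_map w G (edge_deriv G (\<lambda>e x. u e x + a * v e x))
    = (\<lambda>e x. dual_map w G (edge_deriv G u) e x + a * dual_map w G (edge_deriv G v) e x)"
proof (intro ext)
  fix e x
  have d: "edge_deriv G (\<lambda>e x. u e x + a * v e x) e y = edge_deriv G u e y + a * edge_deriv G v e y"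
    if "e \<in> edges G" "y \<in> {0..elen G e}" for e y
    using assms that unfolding eigenspace_iff by (blast intro: edge_deriv_linear)
  have "edge_deriv G (\<lambda>e x. u e x + a * v e x) (Side i) y = edge_deriv G u (Side i) y + a * edge_deriv G v (Side i) y"
    "edge_deriv G (\<lambda>e x. u e x + a * v e x) (Tooth i) y = edge_deriv G u (Tooth i) y + a * edge_deriv G v (Tooth i) y"
    if "i < n" "y \<in> {0..l i}" for i y
    using d[of "Side i" y] d[of "Tooth i" y] that by simp_all
  then show "dual_map w G (edge_deriv G (\<lambda>e x. u e x + a * v e x)) e x
     = dual_map w G (edge_deriv G u) e x + a * dual_map w G (edge_deriv G v) e x"
    by (cases e) (auto simp: algebra_simps)
qed

lemma dual_map_bij:
  assumes \<mu>: "\<mu> \<noteq> 0"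
  shows "bij_betw (\<lambda>u. dual_map w G (edge_deriv G u)) (eigenspace w G \<mu>) (eigenspace w H \<mu>)"
proof -
  interpret S: dual_gears n l H w G by (rule dual_gears_sym)
  define c where "c = - (1 + of_real w) * \<mu>"
  have "1 + complex_of_real w \<noteq> 0"
    using w by (metis add_pos_pos less_irrefl of_real_1 of_real_add of_real_eq_0_iff zero_less_one)
  then have c: "c \<noteq> 0"
    using \<mu> unfolding c_def by (simp only: mult_eq_0_iff neg_equal_0_iff_equal simp_thms)
  define f where "f = (\<lambda>u. dual_map w G (edge_deriv G u))"
  \<comment> \<open>The inverse is the transplantation of the dual gear divided by the factor
    \<open>c\<close> of the double application; \<open>c \<noteq> 0\<close> rests on
    \<open>\<mu> \<noteq> 0\<close> and \<open>w > 0\<close>.\<close>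
  define h where "h = (\<lambda>v. (\<lambda>e x. inverse c * dual_map w H (edge_deriv H v) e x))"
  have hf: "h (f u) = u" if "u \<in> eigenspace w G \<mu>" for u
    unfolding h_def f_def dual_map_dual_map[OF that] c_def[symmetric] using c by (simp add: field_simps)
  have h: "h v \<in> eigenspace w G \<mu>" if "v \<in> eigenspace w H \<mu>" for v
    using eigenspace_linear[OF zero_in_eigenspace S.dual_map_eigenspace(1)[OF that]] by (simp add: h_def)
  have f0: "f (\<lambda>e x. 0) = (\<lambda>e x. 0)"
    using dual_map_linear[OF zero_in_eigenspace zero_in_eigenspace, of "- 1"] by (simp add: f_def)
  have fh: "f (h v) = v" if "v \<in> eigenspace w H \<mu>" for v
  proof -
    have "f (h v) = (\<lambda>e x. f (\<lambda>e x. 0) e x + inverse c * f (dual_map w H (edge_deriv H v)) e x)"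
      using dual_map_linear[OF zero_in_eigenspace S.dual_map_eigenspace(1)[OF that], of "inverse c"]
      by (simp add: f_def h_def)
    also have "\<dots> = v"
      unfolding f0 unfolding f_def S.dual_map_dual_map[OF that] c_def[symmetric] using c by (simp add: field_simps)
    finally show ?thesis .
  qed
  have "bij_betw f (eigenspace w G \<mu>) (eigenspace w H \<mu>)"
    using hf fh h dual_map_eigenspace(1) by (intro bij_betw_byWitness[where f' = h]) (auto simp: f_def)
  then show ?thesis by (simp add: f_def)
qed

lemma eigenspace_dim_eq:
  assumes "\<mu> \<noteq> 0"
  shows "edge_fun.dim (eigenspace w G \<mu>) = edge_fun.dim (eigenspace w H \<mu>)"
  using subspace_eigenspace dual_map_linear dual_map_bij[OF assms]
  by (rule edge_fun_dim_eq_of_bij)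

lemma trivial_eigenspace_dual:
  assumes "\<mu> \<noteq> 0" "eigenspace w G \<mu> = {\<lambda>e x. 0}"
  shows "eigenspace w H \<mu> = {\<lambda>e x. 0}"
proof -
  obtain z where "eigenspace w H \<mu> = {z}"
    using dual_map_bij[OF assms(1)] unfolding assms(2) by (auto simp: bij_betw_def)
  then show ?thesis
    using H.zero_in_eigenspace[of \<mu>] by auto
qed

end

section \<open>The eigenvalue 0\<close>

context weighted_gear
begin

text \<open>On each edge the function is affine. The Neumann condition makes the teeth flat, so the
  Kirchhoff condition forces equal slopes on all sides. Once around the polygon the increments add
  up to this slope times the positive total length and must cancel, so the slope is 0.\<close>

lemma eigenspace_0:
  "u \<in> eigenspace w G 0 \<longleftrightarrow> (\<exists>c. u = (\<lambda>e x. if e \<in> edges G \<and> x \<in> {0..elen G e} then c else 0))"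
proof
  assume "\<exists>c. u = (\<lambda>e x. if e \<in> edges G \<and> x \<in> {0..elen G e} then c else 0)"
  then obtain c where u: "u = (\<lambda>e x. if e \<in> edges G \<and> x \<in> {0..elen G e} then c else 0)" ..
  have "(u e has_vector_derivative 0) (at x within {0..elen G e})"
    if "e \<in> edges G" "x \<in> {0..elen G e}" for e x
    using that by (subst has_vector_derivative_cong_ev[where g = "\<lambda>x. c"]) (auto simp: eventually_at_filter u)
  then have "eigen_pair 0 u (\<lambda>e x. 0)"
    unfolding eigen_pair_def using less_imp_le[OF l] by (auto simp: u)
  then show "u \<in> eigenspace w G 0"
    by (intro eigenspaceI(1)) (auto simp: u)
next
  assume u: "u \<in> eigenspace w G 0"
  define d where "d = edge_deriv G u"
  note p = eigenspaceD(2)[OF u, folded d_def]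
  have dd: "(u e has_vector_derivative d e x) (at x within {0..elen G e})"
      "(d e has_vector_derivative 0) (at x within {0..elen G e})"
    if "e \<in> edges G" "x \<in> {0..elen G e}" for e x
    using p that unfolding eigen_pair_def by simp_all
  have dc: "d e x = d e 0" if "e \<in> edges G" "x \<in> {0..elen G e}" for e x
  proof -
    have "((\<lambda>x. 0) has_integral (d e x - d e 0)) {0..x}"
      using that by (intro fundamental_theorem_of_calculus)
        (auto intro: has_vector_derivative_within_subset[OF dd(2)[OF that(1)]])
    then show ?thesis by simp
  qed
  have uc: "u e x = u e 0 + of_real x * d e 0" if "e \<in> edges G" "x \<in> {0..elen G e}" for e x
  proof -
    have "(d e has_integral (u e x - u e 0)) {0..x}"
      using that by (intro fundamental_theorem_of_calculus)
        (auto intro: has_vector_derivative_within_subset[OF dd(1)[OF that(1)]])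
    then have "((\<lambda>x. d e 0) has_integral (u e x - u e 0)) {0..x}"
      by (rule has_integral_eq[rotated]) (rule dc, use that in auto)
    moreover have "((\<lambda>x. d e 0) has_integral (of_real x * d e 0)) {0..x}"
      using has_integral_const_real[of "d e 0" 0 x] that by (simp add: scaleR_conv_of_real)
    ultimately have "u e x - u e 0 = of_real x * d e 0" by (rule has_integral_unique)
    then show ?thesis by (simp add: algebra_simps)
  qed
  have V: "u (Side (nxt G i)) 0 = u (Side i) (l i)"
      "u (Tooth i) 0 = (if att G i = i then u (Side i) 0 else u (Side i) (l i))"
      "d (Side (nxt G i)) 0 + of_real w * (if att G (nxt G i) = nxt G i then d (Tooth (nxt G i)) 0 else 0)
           = d (Side i) (l i) - of_real w * (if att G i = i then 0 else d (Tooth i) 0)"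
      "d (Tooth i) (l i) = 0" if "i < n" for i
    using p that unfolding eigen_pair_def by blast+
  have t0: "d (Tooth i) 0 = 0" if "i < n" for i
    using dc[of "Tooth i" "l i"] V(4)[OF that] that less_imp_le[OF l[OF that]] by simp
  have s: "d (Side (nxt G i)) 0 = d (Side i) 0" if "i < n" for i
    using V(3)[OF that] t0[OF that] t0[OF nxt_less] that dc[of "Side i" "l i"] less_imp_le[OF l[OF that]]
    by (simp split: if_splits)
  have nS: "nxt G i = Suc i" if "Suc i < n" for i using that by (simp add: nxt_def)
  have b: "d (Side i) 0 = d (Side 0) 0" if "i < n" for i
    using that
  proof (induction i)
    case (Suc i)
    then show ?case using s[of i] nS[of i] by simp
  qed simp
  have st: "u (Side (nxt G i)) 0 = u (Side i) 0 + of_real (l i) * d (Side 0) 0" if "i < n" for i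
    using V(1)[OF that] uc[of "Side i" "l i"] b[OF that] that less_imp_le[OF l[OF that]] by simp
  have bij: "bij_betw (nxt G) {..<n} {..<n}"
  proof (rule bij_betw_imageI)
    show "inj_on (nxt G) {..<n}"
      using nxt_inj by (intro inj_onI) blast
    show "nxt G ` {..<n} = {..<n}"
    proof (intro equalityI subsetI)
      fix v assume "v \<in> {..<n}"
      then show "v \<in> nxt G ` {..<n}" using nxt_surj[of v] by blast
    qed auto
  qed
  have "(\<Sum>i<n. u (Side i) 0) = (\<Sum>i<n. u (Side (nxt G i)) 0)"
    by (rule sum.reindex_bij_betw[OF bij, symmetric])
  also have "\<dots> = (\<Sum>i<n. u (Side i) 0) + of_real (\<Sum>i<n. l i) * d (Side 0) 0"
    using st by (simp add: sum.distrib sum_distrib_right)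
  finally have "of_real (\<Sum>i<n. l i) * d (Side 0) 0 = 0" by simp
  moreover have "(\<Sum>i<n. l i) > 0"
    using n l by (intro sum_pos) (auto simp: lessThan_empty_iff)
  ultimately have d0: "d (Side 0) 0 = 0" by (metis less_irrefl mult_eq_0_iff of_real_eq_0_iff)
  have u0: "u (Side i) 0 = u (Side 0) 0" if "i < n" for i
    using that
  proof (induction i)
    case (Suc i)
    then show ?case using st[of i] nS[of i] d0 by simp
  qed simp
  have uS: "u (Side i) x = u (Side 0) 0" if "i < n" "x \<in> {0..l i}" for i x
    using uc[of "Side i" x] that u0[OF that(1)] b[OF that(1)] d0 by simp
  have uT: "u (Tooth i) x = u (Side 0) 0" if "i < n" "x \<in> {0..l i}" for i x
    using uc[of "Tooth i" x] that t0[OF that(1)] V(2)[OF that(1)]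
      uS[OF that(1), of 0] uS[OF that(1), of "l i"] less_imp_le[OF l[OF that(1)]] by (simp split: if_splits)
  have "u = (\<lambda>e x. if e \<in> edges G \<and> x \<in> {0..elen G e} then u (Side 0) 0 else 0)"
  proof (intro ext)
    fix e x
    show "u e x = (if e \<in> edges G \<and> x \<in> {0..elen G e} then u (Side 0) 0 else 0)"
    proof (cases "e \<in> edges G \<and> x \<in> {0..elen G e}")
      case True
      then have "u e x = u (Side 0) 0"
        by (cases e) (auto intro: uS uT)
      with True show ?thesis by simp
    next
      case False
      then show ?thesis using eigenspaceD(1)[OF u, of e x] by auto
    qed
  qed
  then show "\<exists>c. u = (\<lambda>e x. if e \<in> edges G \<and> x \<in> {0..elen G e} then c else 0)" by blast
qed

lemma zero_notin_resolvent_set: "0 \<notin> resolvent_set w G"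
proof
  assume r: "0 \<in> resolvent_set w G"
  have "(\<lambda>e x. if e \<in> edges G \<and> x \<in> {0..elen G e} then 1 else 0) \<in> eigenspace w G 0"
    unfolding eigenspace_0 by blast
  from resolvent_imp_trivial_eigenspace[OF r this]
  have "(if Side 0 \<in> edges G \<and> 0 \<in> {0..elen G (Side 0)} then 1 else 0) = (0::complex)"
    by (simp only: fun_eq_iff)
  then show False using n l[of 0] by (auto split: if_splits)
qed

end

section \<open>Equality of resolvent sets and multiplicities\<close>

context dual_gears
begin

lemma eigenspace_0_eq: "eigenspace w G 0 = eigenspace w H 0"
proof -
  have "(\<lambda>e x. if e \<in> edges H \<and> x \<in> {0..elen H e} then c else 0)
      = (\<lambda>e x. if e \<in> edges G \<and> x \<in> {0..elen G e} then c else (0::complex))" for c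
    by (auto simp: fun_eq_iff edges_eq elen_eq)
  then show ?thesis
    by (auto simp: set_eq_iff eigenspace_0 H.eigenspace_0)
qed

lemma resolvent_set_eq: "resolvent_set w G = resolvent_set w H"
proof -
  interpret S: dual_gears n l H w G by (rule dual_gears_sym)
  have "\<mu> \<in> resolvent_set w G \<longleftrightarrow> \<mu> \<in> resolvent_set w H" for \<mu>
  proof (cases "\<mu> = 0")
    case True
    then show ?thesis using zero_notin_resolvent_set H.zero_notin_resolvent_set by simp
  next
    case False
    \<comment> \<open>Any complex square root serves as \<open>k\<close>, so
      \<open>resolvent_set_iff\<close> reaches every nonzero \<open>\<mu>\<close>, real or
      not.\<close>
    then have k: "csqrt \<mu> \<noteq> 0" by simp
    show ?thesis
      using resolvent_set_iff[OF k] H.resolvent_set_iff[OF k] trivial_eigenspace_dual[OF False]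
        S.trivial_eigenspace_dual[OF False] by auto
  qed
  then show ?thesis by blast
qed

lemma isospectral: "isospectral w G H"
  unfolding isospectral_def lap_spectrum_def resolvent_set_eq multiplicity_def
  using eigenspace_dim_eq eigenspace_0_eq by metis

end

theorem theorem1:
  fixes n :: nat and l :: "nat \<Rightarrow> real" and G :: gear and w :: real
  assumes "n \<ge> 3"
    and "\<And>i. i < n \<Longrightarrow> l i > 0"
    and "is_gear n l G"
    and "w > 0"
  shows "isospectral w G (dual_gear G)"
proof -
  interpret weighted_gear n l G w
    using assms by unfold_locales
  have "is_gear n l (dual_gear G)"
    using assms(3) by (auto simp: is_gear_def dual_gear_def nxt_def)
  moreover have "att (dual_gear G) i \<noteq> att G i" if "i < n" for i
    using att[OF that] nxt_neq[OF that] by (auto simp: dual_gear_def)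
  ultimately interpret dual_gears n l G w "dual_gear G"
    using assms by unfold_locales
  show ?thesis by (rule isospectral)
qed

end
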